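(* Let $1\le p<\infty$ and let $(X,d,\mu)$ be a compact Cheeger space for the exponent $p$. Let $\{\varepsilon_n\}_{n\ge0}$ be a sequence of positive numbers with $\lim_{n\to\infty}\varepsilon_n=0$. Any sequence $\{f_n\}_{n\ge1}$ in $KS^{1,p}(X)$ such that $$\liminf_{n\to\infty}\Big(E_{p,\varepsilon_n}(f_n)+\|f_n\|_{L^p(X,\mu)}^p\Big)<\infty$$ contains a subsequence that converges strongly in $L^p(X,\mu)$.
   Context: Cheeger space (for $1\le p<\infty$): a locally compact, complete metric space $(X,d)$ with a Radon measure $\mu$ such that, writing $B(x,r)=\{y:d(x,y)<r\}$: (VD) there is $C>0$ with $0<\mu(B(x,2r))\le C\mu(B(x,r))<\infty$ for all $x\in X$, $r>0$; (PI) there are $C>0$, $\lambda\ge1$ such that for every Lipschitz $f$ on $X$ and every ball $B(x,R)$, $\int_{B(x,R)}|f-f_{B(x,R)}|^p d\mu\le CR^p\int_{B(x,\lambda R)}(\mathrm{Lip} f)^p d\mu$, where $f_B=\frac1{\mu(B)}\int_B f\,d\mu$ and $(\mathrm{Lip} f)(y)=\limsup_{r\to0^+}\sup_{d(x,y)\le r}\frac{|f(x)-f(y)|}{r}$. Energies: for $r>0$ and $f\in L^p(X,\mu)$, $E_{p,r}(f)=\frac1{r^p}\int_X\frac1{\mu(B(x,r))}\int_{B(x,r)}|f(y)-f(x)|^p d\mu(y)d\mu(x)$. The Korevaar-Schoen space is $KS^{1,p}(X)=\{f\in L^p(X,\mu):\limsup_{r\to0^+}E_{p,r}(f)<\infty\}$.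 *)

theory Defs
  imports "HOL-Analysis.Analysis"
begin

text \<open>Radon measures are taken as regular Borel measures: finite on compact sets, outer regular on
  Borel sets, inner regular on open sets.\<close>

definition radon_measure :: "'a::metric_space measure \<Rightarrow> bool" where
  "radon_measure M \<longleftrightarrow>
     sets M = sets borel \<and>
     (\<forall>K. compact K \<longrightarrow> emeasure M K < \<infinity>) \<and>
     (\<forall>A\<in>sets borel. emeasure M A = (INF U\<in>{U. open U \<and> A \<subseteq> U}. emeasure M U)) \<and>
     (\<forall>U. open U \<longrightarrow> emeasure M U = (SUP K\<in>{K. compact K \<and> K \<subseteq> U}. emeasure M K))"

definition ennreal_powr :: "ennreal \<Rightarrow> real \<Rightarrow> ennreal" where
  "ennreal_powr a p = (if a = \<infinity> then \<infinity> else ennreal (enn2real a powr p))"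

definition pointwise_Lip :: "('a::metric_space \<Rightarrow> real) \<Rightarrow> 'a \<Rightarrow> ennreal" where
  "pointwise_Lip f y =
     Limsup (at_right (0::real)) (\<lambda>r. SUP x\<in>cball y r. ennreal (\<bar>f x - f y\<bar> / r))"

definition ball_average :: "'a::metric_space measure \<Rightarrow> 'a \<Rightarrow> real \<Rightarrow> ('a \<Rightarrow> real) \<Rightarrow> real" where
  "ball_average M x R f = (1 / measure M (ball x R)) * (LINT y:ball x R|M. f y)"

text \<open>The underlying space is the whole type. All balls have finite measure and a Lipschitz function
  is bounded on every ball, so the Bochner integral in \<^const>\<open>ball_average\<close> is genuine; the two sides
  of the Poincare inequality are stated as integrals in \<^typ>\<open>ennreal\<close>.\<close>

locale cheeger_space =
  fixes p :: real and M :: "'a::metric_space measure"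
  assumes locally_compact: "locally_compact_space (euclidean :: 'a topology)"
    and complete: "complete (UNIV :: 'a set)"
    and radon: "radon_measure M"
    and doubling: "\<exists>C::real. C > 0 \<and> (\<forall>x r. r > 0 \<longrightarrow>
          0 < emeasure M (ball x (2 * r)) \<and>
          emeasure M (ball x (2 * r)) \<le> ennreal C * emeasure M (ball x r) \<and>
          ennreal C * emeasure M (ball x r) < \<infinity>)"
    and poincare: "\<exists>(C::real) (\<Lambda>::real). C > 0 \<and> \<Lambda> \<ge> 1 \<and>
          (\<forall>f :: 'a \<Rightarrow> real. (\<exists>L. L-lipschitz_on UNIV f) \<longrightarrow>
            (\<forall>x R. R > 0 \<longrightarrow>
              (\<integral>\<^sup>+ y\<in>ball x R. ennreal (\<bar>f y - ball_average M x R f\<bar> powr p) \<partial>M)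
              \<le> ennreal (C * R powr p) *
                 (\<integral>\<^sup>+ y\<in>ball x (\<Lambda> * R). ennreal_powr (pointwise_Lip f y) p \<partial>M)))"

text \<open>Elements of \<open>L\<^sup>p\<close> are represented by functions rather than almost-everywhere classes.\<close>

definition Lp_funs :: "real \<Rightarrow> 'a measure \<Rightarrow> ('a \<Rightarrow> real) set" where
  "Lp_funs p M = {f \<in> borel_measurable M. integrable M (\<lambda>x. \<bar>f x\<bar> powr p)}"

definition Lp_norm :: "real \<Rightarrow> 'a measure \<Rightarrow> ('a \<Rightarrow> real) \<Rightarrow> real" where
  "Lp_norm p M f = (LINT x|M. \<bar>f x\<bar> powr p) powr (1 / p)"

definition KS_energy ::
  "real \<Rightarrow> 'a::metric_space measure \<Rightarrow> real \<Rightarrow> ('a \<Rightarrow> real) \<Rightarrow> ennreal" where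
  "KS_energy p M r f =
     ennreal (1 / r powr p) *
     (\<integral>\<^sup>+ x. (1 / emeasure M (ball x r)) *
             (\<integral>\<^sup>+ y\<in>ball x r. ennreal (\<bar>f y - f x\<bar> powr p) \<partial>M) \<partial>M)"

definition KS_space :: "real \<Rightarrow> 'a::metric_space measure \<Rightarrow> ('a \<Rightarrow> real) set" where
  "KS_space p M = {f \<in> Lp_funs p M. Limsup (at_right 0) (\<lambda>r. KS_energy p M r f) < \<infinity>}"

end

theory Submission
  imports Defs "HOL-Library.Diagonal_Subsequence"
begin

text \<open>Replace each \<open>f\<^sub>n\<close> by its average \<open>g\<^sub>n\<close> against a Lipschitz bump at scale \<open>\<epsilon>\<^sub>n\<close>. By doubling, both
  \<open>\<bar>f\<^sub>n - g\<^sub>n\<bar>\<close> and \<open>\<epsilon>\<^sub>n Lip g\<^sub>n\<close> are bounded at \<open>x\<close> by a constant times the average of \<open>\<bar>f\<^sub>n - f\<^sub>n x\<bar>\<close> over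
  \<open>B(x, \<epsilon>\<^sub>n)\<close>, so that \<open>\<integral> \<bar>f\<^sub>n - g\<^sub>n\<bar>\<^sup>p\<close> is at most a constant times \<open>\<epsilon>\<^sub>n\<^sup>p E\<close> and \<open>\<integral> (Lip g\<^sub>n)\<^sup>p\<close> at most a constant
  times \<open>E\<close>, where \<open>E\<close> is the energy of \<open>f\<^sub>n\<close> at scale \<open>\<epsilon>\<^sub>n\<close>. The Poincare inequality on the balls of
  radius \<open>R\<close> around a maximal \<open>R\<close>-separated set, whose dilates overlap boundedly, then shows that \<open>g\<^sub>n\<close>
  is determined up to \<open>O(R)\<close> in \<open>L\<^sup>p\<close> by finitely many bounded averages. Pigeonhole, a diagonal argument and
  completeness of \<open>L\<^sup>p\<close> conclude.\<close>

section \<open>Elementary inequalities\<close>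

text \<open>The distance \<open>\<bar>a - c\<bar>\<close> is at most twice the larger of the two
  others, and the power of a maximum is at most the sum of the powers. The argument is the same for
  all \<open>0 \<le> p\<close>, without convexity.\<close>

lemma powr_diff_triangle:
  fixes a b c p :: real
  assumes "0 \<le> p"
  shows "\<bar>a - c\<bar> powr p \<le> 2 powr p * (\<bar>a - b\<bar> powr p + \<bar>b - c\<bar> powr p)"
proof -
  define m where "m = max \<bar>a - b\<bar> \<bar>b - c\<bar>"
  have "\<bar>a - c\<bar> powr p \<le> (2 * m) powr p"
    using assms by (intro powr_mono2) (auto simp: m_def max_def abs_if)
  also have "\<dots> = 2 powr p * m powr p"
    by (simp add: powr_mult m_def)
  also have "\<dots> \<le> 2 powr p * (\<bar>a - b\<bar> powr p + \<bar>b - c\<bar> powr p)"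
    by (intro mult_left_mono) (auto simp: m_def max_def)
  finally show ?thesis .
qed

text \<open>Two triangle steps, with the constant of the first summand enlarged to
  \<open>4 powr p\<close>. It compares two functions \<open>u\<close>, \<open>v\<close> through
  approximants \<open>a\<close>, \<open>b\<close>, which are ball averages in one application and
  mollifications in another.\<close>

lemma powr_diff_quadrangle:
  fixes a b u v p :: real
  assumes p: "0 \<le> p"
  shows "\<bar>u - v\<bar> powr p \<le> 4 powr p * (\<bar>u - a\<bar> powr p + \<bar>v - b\<bar> powr p + \<bar>a - b\<bar> powr p)"
proof -
  have 2: "1 \<le> 2 powr p" "(4::real) powr p = 2 powr p * 2 powr p"
    using p powr_mult[of 2 2 p] by (auto simp: ge_one_powr_ge_zero)
  have "\<bar>u - v\<bar> powr p \<le> 2 powr p * (\<bar>u - a\<bar> powr p + \<bar>a - v\<bar> powr p)"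
    by (rule powr_diff_triangle[OF p])
  also have "\<dots> \<le> 2 powr p * (2 powr p * \<bar>u - a\<bar> powr p + 2 powr p * (\<bar>a - b\<bar> powr p + \<bar>b - v\<bar> powr p))"
    using mult_right_mono[OF 2(1), of "\<bar>u - a\<bar> powr p"]
    by (intro mult_left_mono add_mono powr_diff_triangle p) auto
  finally show ?thesis
    by (simp add: 2(2) algebra_simps abs_minus_commute)
qed

text \<open>Integrated with a suitable \<open>\<eta>\<close>, this takes the place of the inequalities of Hoelder and Jensen, up to
  constants.\<close>

lemma le_add_powr:
  fixes \<eta> t p :: real
  assumes "0 < \<eta>" "0 \<le> t" "1 \<le> p"
  shows "t \<le> \<eta> + \<eta> powr (1 - p) * t powr p"
proof (cases "t \<le> \<eta>")
  case True
  then show ?thesis by (simp add: add_increasing2)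
next
  case False
  have "t = t powr (1 - p) * t powr p"
    using False assms by (simp flip: powr_add)
  also have "\<dots> \<le> \<eta> powr (1 - p) * t powr p"
    using False assms by (intro mult_right_mono powr_mono2') auto
  finally show ?thesis using assms by simp
qed

text \<open>The next three lemmas do not assume measurability: on non-measurable functions
  \<open>\<integral>\<^sup>+\<close> is the lower integral, which is still monotone and superadditive. So neither the pointwise
  Lipschitz constant nor the integrand of \<^const>\<open>KS_energy\<close> has to be proved measurable.\<close>

lemma nn_integral_cmult_le:
  assumes "0 < c"
  shows "(\<integral>\<^sup>+ x. ennreal c * h x \<partial>M) \<le> ennreal c * (\<integral>\<^sup>+ x. h x \<partial>M)"
proof -
  \<comment> \<open>A simple minorant \<open>g\<close> of \<open>c * h\<close> becomes a simple
    minorant of \<open>h\<close> after division by \<open>c\<close>; the scalar is only ever pulled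
    out of the integral of the measurable \<open>g\<close>.\<close>
  have "integral\<^sup>S M g \<le> ennreal c * integral\<^sup>N M h"
    if g: "simple_function M g" "g \<le> (\<lambda>x. ennreal c * h x)" for g
  proof -
    have cc: "ennreal c * (ennreal (1 / c) * z) = z" "ennreal (1 / c) * (ennreal c * z) = z" for z
      using assms by (simp_all flip: mult.assoc ennreal_mult)
    have gm: "g \<in> borel_measurable M"
      using g(1) by (rule borel_measurable_simple_function)
    have "ennreal (1 / c) * g x \<le> h x" for x
      using mult_left_mono[OF le_funD[OF g(2), of x], of "ennreal (1 / c)"] by (simp add: cc)
    then have "(\<integral>\<^sup>+ x. ennreal (1 / c) * g x \<partial>M) \<le> integral\<^sup>N M h"
      by (intro nn_integral_mono)
    then have "ennreal (1 / c) * integral\<^sup>N M g \<le> integral\<^sup>N M h"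
      by (simp add: nn_integral_cmult gm)
    then have "ennreal c * (ennreal (1 / c) * integral\<^sup>N M g) \<le> ennreal c * integral\<^sup>N M h"
      by (rule mult_left_mono) simp
    then show ?thesis
      using nn_integral_eq_simple_integral[OF g(1)] by (simp add: cc)
  qed
  then show ?thesis
    unfolding nn_integral_def[of M "\<lambda>x. ennreal c * h x"] by (auto intro!: SUP_least)
qed

lemma nn_integral_superadditive:
  "(\<integral>\<^sup>+ x. g x \<partial>M) + (\<integral>\<^sup>+ x. h x \<partial>M) \<le> (\<integral>\<^sup>+ x. g x + h x \<partial>M)"
proof -
  have *: "integral\<^sup>S M s + integral\<^sup>S M t \<le> (\<integral>\<^sup>+ x. g x + h x \<partial>M)"
    if "simple_function M s" "s \<le> g" "simple_function M t" "t \<le> h" for s t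
  proof -
    have "integral\<^sup>S M s + integral\<^sup>S M t = (\<integral>\<^sup>+ x. s x + t x \<partial>M)"
      using that by (simp add: nn_integral_add borel_measurable_simple_function
          flip: nn_integral_eq_simple_integral)
    also have "\<dots> \<le> (\<integral>\<^sup>+ x. g x + h x \<partial>M)"
      using that by (intro nn_integral_mono add_mono) (auto simp: le_fun_def)
    finally show ?thesis .
  qed
  have ne: "{s. simple_function M s \<and> s \<le> u} \<noteq> {}" for u :: "'a \<Rightarrow> ennreal"
    by (auto intro!: exI[of _ "\<lambda>_. 0"] simp: le_fun_def)
  have "integral\<^sup>S M s + integral\<^sup>N M h \<le> (\<integral>\<^sup>+ x. g x + h x \<partial>M)"
    if "simple_function M s" "s \<le> g" for s
    unfolding nn_integral_def[of M h] ennreal_SUP_add_right[OF ne]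
    using * that by (intro SUP_least) auto
  then show ?thesis
    unfolding nn_integral_def[of M g] ennreal_SUP_add_left[OF ne, symmetric]
    by (intro SUP_least) auto
qed

lemma sum_nn_integral_le:
  assumes "finite S"
  shows "(\<Sum>s\<in>S. \<integral>\<^sup>+ x. g s x \<partial>M) \<le> (\<integral>\<^sup>+ x. (\<Sum>s\<in>S. g s x) \<partial>M)"
  using assms
proof induction
  case (insert a S)
  have "(\<Sum>s\<in>insert a S. \<integral>\<^sup>+ x. g s x \<partial>M) \<le> (\<integral>\<^sup>+ x. g a x \<partial>M) + (\<integral>\<^sup>+ x. (\<Sum>s\<in>S. g s x) \<partial>M)"
    using insert by (simp add: add_left_mono)
  also have "\<dots> \<le> (\<integral>\<^sup>+ x. g a x + (\<Sum>s\<in>S. g s x) \<partial>M)"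
    by (rule nn_integral_superadditive)
  finally show ?case
    using insert by simp
qed simp

section \<open>Completeness and sequential compactness\<close>

text \<open>On a finite measure space \<open>1 + \<bar>u\<bar> powr p\<close> is an integrable
  majorant of \<open>\<bar>u\<bar>\<close>.\<close>

lemma (in finite_measure) integrable_of_integrable_powr:
  fixes u :: "'a \<Rightarrow> real"
  assumes "1 \<le> p" "u \<in> borel_measurable M" "integrable M (\<lambda>x. \<bar>u x\<bar> powr p)"
  shows "integrable M u"
proof (rule Bochner_Integration.integrable_bound)
  show "integrable M (\<lambda>x. 1 + \<bar>u x\<bar> powr p)"
    using assms by simp
  show "AE x in M. norm (u x) \<le> norm (1 + \<bar>u x\<bar> powr p)"
    using le_add_powr[of 1 "\<bar>u _\<bar>" p] assms by simp
qed (use assms in simp)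

lemma integrable_powr_diff:
  fixes u v :: "'a \<Rightarrow> real"
  assumes p: "0 \<le> p" and [measurable]: "u \<in> borel_measurable M" "v \<in> borel_measurable M"
    and i: "integrable M (\<lambda>x. \<bar>u x\<bar> powr p)" "integrable M (\<lambda>x. \<bar>v x\<bar> powr p)"
  shows "integrable M (\<lambda>x. \<bar>u x - v x\<bar> powr p)"
proof (rule Bochner_Integration.integrable_bound)
  show "integrable M (\<lambda>x. 2 powr p * (\<bar>u x\<bar> powr p + \<bar>v x\<bar> powr p))"
    using i by simp
  show "AE x in M. norm (\<bar>u x - v x\<bar> powr p) \<le> norm (2 powr p * (\<bar>u x\<bar> powr p + \<bar>v x\<bar> powr p))"
    using powr_diff_triangle[OF p, of "u _" "v _" 0] by simp
qed simp

lemma nn_integral_powr_diff_triangle: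
  fixes u v w :: "'a \<Rightarrow> real"
  assumes p: "0 \<le> p" and [measurable]: "u \<in> borel_measurable M" "v \<in> borel_measurable M"
    "w \<in> borel_measurable M"
  shows "(\<integral>\<^sup>+ x. ennreal (\<bar>u x - w x\<bar> powr p) \<partial>M)
    \<le> ennreal (2 powr p) * ((\<integral>\<^sup>+ x. ennreal (\<bar>u x - v x\<bar> powr p) \<partial>M)
        + (\<integral>\<^sup>+ x. ennreal (\<bar>v x - w x\<bar> powr p) \<partial>M))"
proof -
  have "(\<integral>\<^sup>+ x. ennreal (\<bar>u x - w x\<bar> powr p) \<partial>M)
    \<le> (\<integral>\<^sup>+ x. ennreal (2 powr p) * (ennreal (\<bar>u x - v x\<bar> powr p) + ennreal (\<bar>v x - w x\<bar> powr p)) \<partial>M)"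
    using powr_diff_triangle[OF p]
    by (intro nn_integral_mono) (simp flip: ennreal_plus ennreal_mult)
  also have "\<dots> = ennreal (2 powr p) * ((\<integral>\<^sup>+ x. ennreal (\<bar>u x - v x\<bar> powr p) \<partial>M)
        + (\<integral>\<^sup>+ x. ennreal (\<bar>v x - w x\<bar> powr p) \<partial>M))"
    by (simp add: nn_integral_cmult nn_integral_add)
  finally show ?thesis .
qed

text \<open>Since the measure is finite, the sequence is also Cauchy in L1, which yields a
  subsequence converging almost everywhere. Fatou's lemma along this subsequence then gives
  convergence of the whole sequence in Lp.\<close>

lemma (in finite_measure) Lp_complete:
  fixes u :: "nat \<Rightarrow> 'a \<Rightarrow> real"
  assumes p: "1 \<le> p" and u: "\<And>n. u n \<in> Lp_funs p M"
    and cau: "\<And>\<delta>. 0 < \<delta> \<Longrightarrow> \<exists>N. \<forall>i\<ge>N. \<forall>j\<ge>N. (\<integral>\<^sup>+ x. ennreal (\<bar>u i x - u j x\<bar> powr p) \<partial>M) \<le> ennreal \<delta>"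
  shows "\<exists>g\<in>Lp_funs p M. (\<lambda>n. Lp_norm p M (\<lambda>x. u n x - g x)) \<longlonglongrightarrow> 0"
proof -
  have um[measurable]: "u n \<in> borel_measurable M" and ui: "integrable M (\<lambda>x. \<bar>u n x\<bar> powr p)" for n
    using u[of n] by (auto simp: Lp_funs_def)
  have dint: "integrable M (\<lambda>x. \<bar>u i x - u j x\<bar> powr p)" for i j
    using p by (intro integrable_powr_diff ui um) auto
  have u1: "integrable M (u n)" for n
    using p um ui by (rule integrable_of_integrable_powr)
  have L1: "\<exists>N. \<forall>i\<ge>N. \<forall>j\<ge>N. (LINT x|M. norm (u i x - u j x)) < e" if "0 < e" for e
  proof -
    \<comment> \<open>First \<open>\<eta>\<close> makes the constant term of
      \<open>le_add_powr\<close> integrate to less than \<open>e / 2\<close>; then \<delta> does the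
      same for the power term, whose factor \<open>\<eta> powr (1 - p)\<close> is by now
      fixed.\<close>
    define \<eta> where "\<eta> = e / (4 * (measure M (space M) + 1))"
    have m0: "0 \<le> measure M (space M)" by simp
    have \<eta>: "0 < \<eta>" "\<eta> * measure M (space M) < e / 2"
      using that m0 unfolding \<eta>_def by (auto simp: field_simps add_strict_increasing intro!: divide_pos_pos)
    define \<delta> where "\<delta> = e / (4 * \<eta> powr (1 - p))"
    have \<delta>: "0 < \<delta>" "\<eta> powr (1 - p) * \<delta> < e / 2"
      using that \<eta> by (auto simp: \<delta>_def)
    obtain N where N: "\<And>i j. i \<ge> N \<Longrightarrow> j \<ge> N \<Longrightarrow> (\<integral>\<^sup>+ x. ennreal (\<bar>u i x - u j x\<bar> powr p) \<partial>M) \<le> ennreal \<delta>"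
      using cau[OF \<delta>(1)] by blast
    have "(LINT x|M. norm (u i x - u j x)) < e" if ij: "i \<ge> N" "j \<ge> N" for i j
    proof -
      have "ennreal (LINT x|M. \<bar>u i x - u j x\<bar> powr p) \<le> ennreal \<delta>"
        using N[OF ij] dint by (simp add: nn_integral_eq_integral)
      then have le: "(LINT x|M. \<bar>u i x - u j x\<bar> powr p) \<le> \<delta>"
        using \<delta>(1) by (simp add: ennreal_le_iff)
      have "(LINT x|M. norm (u i x - u j x)) \<le> (LINT x|M. \<eta> + \<eta> powr (1 - p) * \<bar>u i x - u j x\<bar> powr p)"
        using u1 dint le_add_powr[OF \<eta>(1) _ p]
        by (intro integral_mono) auto
      also have "\<dots> = \<eta> * measure M (space M) + \<eta> powr (1 - p) * (LINT x|M. \<bar>u i x - u j x\<bar> powr p)"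
        using dint by simp
      also have "\<dots> \<le> \<eta> * measure M (space M) + \<eta> powr (1 - p) * \<delta>"
        using le by (intro add_left_mono mult_left_mono) auto
      finally show ?thesis
        using \<eta> \<delta> by linarith
    qed
    then show ?thesis by blast
  qed
  obtain r where r: "strict_mono r" "AE x in M. Cauchy (\<lambda>i. u (r i) x)"
    using cauchy_L1_AE_cauchy_subseq[OF u1 L1] by blast
  define g where "g x = lim (\<lambda>i. u (r i) x)" for x
  have gm[measurable]: "g \<in> borel_measurable M"
    unfolding g_def by measurable
  have lim: "AE x in M. (\<lambda>i. u (r i) x) \<longlonglongrightarrow> g x"
    using r(2) by eventually_elim (simp add: g_def Cauchy_convergent_iff convergent_LIMSEQ_iff)
  have conv: "\<exists>N. \<forall>i\<ge>N. (\<integral>\<^sup>+ x. ennreal (\<bar>u i x - g x\<bar> powr p) \<partial>M) \<le> ennreal \<delta>" if \<delta>: "0 < \<delta>" for \<delta>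
  proof -
    obtain N where N: "\<And>i j. i \<ge> N \<Longrightarrow> j \<ge> N \<Longrightarrow> (\<integral>\<^sup>+ x. ennreal (\<bar>u i x - u j x\<bar> powr p) \<partial>M) \<le> ennreal \<delta>"
      using cau[OF \<delta>] by blast
    have "(\<integral>\<^sup>+ x. ennreal (\<bar>u i x - g x\<bar> powr p) \<partial>M) \<le> ennreal \<delta>" if i: "i \<ge> N" for i
    proof -
      \<comment> \<open>With \<open>i\<close> fixed, \<open>j\<close> runs along the subsequence.
        Fatou applies, and \<open>r j \<ge> j\<close> keeps the index in the Cauchy range.\<close>
      have "AE x in M. ennreal (\<bar>u i x - g x\<bar> powr p)
          = liminf (\<lambda>j. ennreal (\<bar>u i x - u (r j) x\<bar> powr p))"
        using lim
      proof eventually_elim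
        case (elim x)
        have "(\<lambda>j. \<bar>u i x - u (r j) x\<bar>) \<longlonglongrightarrow> \<bar>u i x - g x\<bar>"
          by (intro tendsto_rabs tendsto_diff tendsto_const elim)
        then have "(\<lambda>j. ennreal (\<bar>u i x - u (r j) x\<bar> powr p)) \<longlonglongrightarrow> ennreal (\<bar>u i x - g x\<bar> powr p)"
          using p by (intro tendsto_ennrealI tendsto_powr2 tendsto_const) auto
        then show ?case
          by (rule lim_imp_Liminf[OF sequentially_bot, symmetric])
      qed
      then have "(\<integral>\<^sup>+ x. ennreal (\<bar>u i x - g x\<bar> powr p) \<partial>M)
          = (\<integral>\<^sup>+ x. liminf (\<lambda>j. ennreal (\<bar>u i x - u (r j) x\<bar> powr p)) \<partial>M)"
        by (rule nn_integral_cong_AE)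
      also have "\<dots> \<le> liminf (\<lambda>j. \<integral>\<^sup>+ x. ennreal (\<bar>u i x - u (r j) x\<bar> powr p) \<partial>M)"
        by (intro nn_integral_liminf) measurable
      also have "\<dots> \<le> liminf (\<lambda>j. ennreal \<delta>)"
      proof (intro Liminf_mono)
        show "\<forall>\<^sub>F j in sequentially. (\<integral>\<^sup>+ x. ennreal (\<bar>u i x - u (r j) x\<bar> powr p) \<partial>M) \<le> ennreal \<delta>"
          unfolding eventually_sequentially
          by (intro exI[of _ N] allI impI N i) (rule order_trans[OF _ seq_suble[OF r(1)]])
      qed
      finally show ?thesis by (simp add: Liminf_const)
    qed
    then show ?thesis by blast
  qed
  obtain N where N: "(\<integral>\<^sup>+ x. ennreal (\<bar>u N x - g x\<bar> powr p) \<partial>M) \<le> ennreal 1"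
    using conv[of 1] by auto
  have dN: "integrable M (\<lambda>x. \<bar>u N x - g x\<bar> powr p)"
    using le_less_trans[OF N] by (intro integrableI_bounded) auto
  \<comment> \<open>\<open>g\<close> is recovered as \<open>u N - (u N - g)\<close>, a difference of
    two functions in Lp.\<close>
  have gi: "integrable M (\<lambda>x. \<bar>g x\<bar> powr p)"
    using integrable_powr_diff[of p "u N" M "\<lambda>x. u N x - g x"] dN ui[of N] p by simp
  then have g: "g \<in> Lp_funs p M"
    by (simp add: Lp_funs_def)
  have "(\<lambda>n. LINT x|M. \<bar>u n x - g x\<bar> powr p) \<longlonglongrightarrow> 0"
  proof (rule LIMSEQ_I)
    fix e :: real assume e: "0 < e"
    obtain N where N: "\<And>i. i \<ge> N \<Longrightarrow> (\<integral>\<^sup>+ x. ennreal (\<bar>u i x - g x\<bar> powr p) \<partial>M) \<le> ennreal (e / 2)"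
      using conv[of "e / 2"] e by auto
    have "norm ((LINT x|M. \<bar>u n x - g x\<bar> powr p) - 0) < e" if "n \<ge> N" for n
    proof -
      have "integrable M (\<lambda>x. \<bar>u n x - g x\<bar> powr p)"
        using p by (intro integrable_powr_diff ui gi) auto
      then have "(LINT x|M. \<bar>u n x - g x\<bar> powr p) \<le> e / 2"
        using N[OF that] e by (simp add: nn_integral_eq_integral ennreal_le_iff)
      moreover have "0 \<le> (LINT x|M. \<bar>u n x - g x\<bar> powr p)"
        by simp
      ultimately show ?thesis using e by simp
    qed
    then show "\<exists>N. \<forall>n\<ge>N. norm ((LINT x|M. \<bar>u n x - g x\<bar> powr p) - 0) < e"
      by blast
  qed
  then have "(\<lambda>n. Lp_norm p M (\<lambda>x. u n x - g x)) \<longlonglongrightarrow> 0 powr (1 / p)"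
    unfolding Lp_norm_def using p by (intro tendsto_powr2 tendsto_const) auto
  with g show ?thesis by auto
qed

text \<open>Diagonal argument: having all mutual values of \<open>D\<close> at most
  \<open>e n\<close> is inherited by subsequences, so the diagonal sequence has this property for
  each \<open>n\<close> from index \<open>Suc n\<close> on.\<close>

lemma Cauchy_subseq_of_small_subseqs:
  fixes D :: "nat \<Rightarrow> nat \<Rightarrow> 'b::linorder"
  assumes "\<And>(n::nat) s. strict_mono s \<Longrightarrow> \<exists>r. strict_mono (r::nat \<Rightarrow> nat) \<and> (\<forall>i j. D (s (r i)) (s (r j)) \<le> e n)"
  shows "\<exists>r. strict_mono (r::nat \<Rightarrow> nat) \<and> (\<forall>n. \<exists>N. \<forall>i\<ge>N. \<forall>j\<ge>N. D (r i) (r j) \<le> e n)"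
proof -
  define P where "P = (\<lambda>n (s::nat \<Rightarrow> nat). \<forall>i j. D (s i) (s j) \<le> e n)"
  interpret subseqs P
    by standard (use assms in \<open>auto simp: P_def o_def\<close>)
  have P: "P k (diagseq \<circ> (+) (Suc k))" for k
    by (rule diagseq_holds) (auto simp: P_def)
  have "D (diagseq i) (diagseq j) \<le> e n" if "Suc n \<le> i" "Suc n \<le> j" for i j n
  proof -
    have "D (diagseq (Suc n + (i - Suc n))) (diagseq (Suc n + (j - Suc n))) \<le> e n"
      using P[of n] unfolding P_def o_def by blast
    then show ?thesis using that by simp
  qed
  then show ?thesis
    using subseq_diagseq by blast
qed

section \<open>Mollification in doubling spaces\<close>

text \<open>A tent of height 1 and slope \<open>2 / e\<close>. Its support has radius
  \<open>e / 2\<close> rather than \<open>e\<close>, so that moving the centre by at most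
  \<open>e / 2\<close> keeps it inside the ball of radius \<open>e\<close> about the old
  centre.\<close>

definition bump :: "real \<Rightarrow> 'a::metric_space \<Rightarrow> 'a \<Rightarrow> real" where
  "bump e x y = max 0 (1 - 2 * dist x y / e)"

lemma bump_nonneg: "0 \<le> bump e x y"
  and bump_le_1: "0 < e \<Longrightarrow> bump e x y \<le> 1"
  and bump_eq_0: "0 < e \<Longrightarrow> e / 2 \<le> dist x y \<Longrightarrow> bump e x y = 0"
  and bump_ge_half: "0 < e \<Longrightarrow> dist x y \<le> e / 4 \<Longrightarrow> 1 / 2 \<le> bump e x y"
  by (auto simp: bump_def field_simps)

lemma bump_lipschitz:
  assumes "0 < e"
  shows "\<bar>bump e x y - bump e x' y\<bar> \<le> 2 * dist x x' / e"
proof -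
  have "\<bar>bump e x y - bump e x' y\<bar> \<le> \<bar>2 * dist x y / e - 2 * dist x' y / e\<bar>"
    unfolding bump_def by linarith
  also have "2 * dist x y / e - 2 * dist x' y / e = 2 * (dist x y - dist x' y) / e"
    by (simp only: diff_divide_distrib right_diff_distrib)
  also have "\<bar>2 * (dist x y - dist x' y) / e\<bar> = 2 * \<bar>dist x y - dist x' y\<bar> / e"
    using assms by (simp only: abs_mult abs_divide abs_numeral abs_of_pos)
  also have "\<dots> \<le> 2 * dist x x' / e"
    using assms dist_triangle[of x y x'] dist_triangle[of x' y x]
    by (intro divide_right_mono mult_left_mono) (auto simp: dist_commute)
  finally show ?thesis .
qed

lemma continuous_on_bump: "continuous_on A (bump e x)"
  unfolding bump_def divide_inverse by (intro continuous_intros)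

definition bump_mass :: "'a::metric_space measure \<Rightarrow> real \<Rightarrow> 'a \<Rightarrow> real" where
  "bump_mass M e x = (LINT y|M. bump e x y)"

definition mollify :: "'a::metric_space measure \<Rightarrow> real \<Rightarrow> ('a \<Rightarrow> real) \<Rightarrow> 'a \<Rightarrow> real" where
  "mollify M e f x = (LINT y|M. bump e x y * f y) / bump_mass M e x"

text \<open>The oscillation is measured from the value \<open>f x\<close> at the centre, not from
  the mean, to match the integrand of \<open>KS_energy\<close>.\<close>

definition ball_osc :: "'a::metric_space measure \<Rightarrow> real \<Rightarrow> ('a \<Rightarrow> real) \<Rightarrow> 'a \<Rightarrow> real" where
  "ball_osc M e f x = ball_average M x e (\<lambda>y. \<bar>f y - f x\<bar>)"

text \<open>What compactness and the doubling condition provide, in terms of the real-valued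
  \<open>measure\<close>. Boundedness of the space makes the masses of balls of a given radius
  uniformly positive.\<close>

locale doubling_bounded =
  fixes M :: "'a::metric_space measure" and C :: real
  assumes sets_M: "sets M = sets borel"
    and finite_M: "emeasure M UNIV < \<infinity>"
    and ball_pos: "\<And>x r. 0 < r \<Longrightarrow> 0 < measure M (ball x r)"
    and doubling: "\<And>x r. 0 < r \<Longrightarrow> measure M (ball x (2 * r)) \<le> C * measure M (ball x r)"
    and bounded_UNIV: "bounded (UNIV :: 'a set)"
begin

lemma space_M: "space M = UNIV"
  using sets_eq_imp_space_eq[OF sets_M] by simp

sublocale finite_measure M
  using finite_M by (intro finite_measureI) (simp add: space_M)

lemma sets_ball [measurable, simp]: "ball x r \<in> sets M"
  by (simp add: sets_M)

lemma measurable_continuous: "continuous_on UNIV g \<Longrightarrow> g \<in> borel_measurable M"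
  using borel_measurable_continuous_onI measurable_cong_sets[OF sets_M refl] by blast

section \<open>Masses of balls and of bumps under doubling\<close>

lemma C_ge_1: "1 \<le> C"
proof -
  fix x :: 'a
  have "measure M (ball x 1) \<le> measure M (ball x (2 * 1))"
    by (intro finite_measure_mono) auto
  also have "\<dots> \<le> C * measure M (ball x 1)"
    by (rule doubling) simp
  finally show ?thesis
    using ball_pos[of 1 x] by simp
qed

lemma doubling_iterate: "0 < r \<Longrightarrow> measure M (ball x (2 ^ k * r)) \<le> C ^ k * measure M (ball x r)"
proof (induction k)
  case (Suc k)
  have "measure M (ball x (2 * (2 ^ k * r))) \<le> C * measure M (ball x (2 ^ k * r))"
    using Suc.prems by (intro doubling) simp
  also have "\<dots> \<le> C * (C ^ k * measure M (ball x r))"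
    using Suc C_ge_1 by (intro mult_left_mono) auto
  finally show ?case by (simp add: mult.assoc)
qed simp

lemma bump_measurable [measurable]: "bump e x \<in> borel_measurable M"
  by (rule measurable_continuous[OF continuous_on_bump])

lemma integrable_bump_mult:
  assumes "0 < e" "integrable M f"
  shows "integrable M (\<lambda>y. bump e x y * f y)"
proof (rule Bochner_Integration.integrable_bound[OF assms(2)])
  show "AE y in M. norm (bump e x y * f y) \<le> norm (f y)"
    using assms(1) by (auto simp: abs_mult bump_nonneg bump_le_1 mult_left_le_one_le)
qed (use assms in measurable)

lemma integrable_bump: "0 < e \<Longrightarrow> integrable M (bump e x)"
  using integrable_bump_mult[of e "\<lambda>_. 1"] by simp

text \<open>The ball about \<open>x0\<close> lies in the ball of radius \<open>2 * e\<close> about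
  \<open>x\<close>. Three doublings compare that with radius \<open>e / 4\<close>, where the bump is
  at least \<open>1 / 2\<close>; hence the constant \<open>2 * C ^ 3\<close>. The shift of centre is
  needed for the Lipschitz estimate.\<close>

lemma ball_le_bump_mass:
  assumes "0 < e" "dist x x0 \<le> e / 2"
  shows "measure M (ball x0 e) \<le> 2 * C ^ 3 * bump_mass M e x"
proof -
  have "ball x0 e \<subseteq> ball x (2 ^ 3 * (e / 4))"
  proof
    fix y assume "y \<in> ball x0 e"
    then show "y \<in> ball x (2 ^ 3 * (e / 4))"
      using assms dist_triangle[of x y x0] by simp
  qed
  then have "measure M (ball x0 e) \<le> measure M (ball x (2 ^ 3 * (e / 4)))"
    by (intro finite_measure_mono) auto
  also have "\<dots> \<le> C ^ 3 * measure M (ball x (e / 4))"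
    using assms by (intro doubling_iterate) simp
  finally have 1: "measure M (ball x0 e) \<le> C ^ 3 * measure M (ball x (e / 4))" .
  have "measure M (ball x (e / 4)) = (LINT y|M. indicator (ball x (e / 4)) y)"
    by simp
  also have "\<dots> \<le> (LINT y|M. 2 * bump e x y)"
  proof (rule integral_mono)
    show "indicator (ball x (e / 4)) y \<le> 2 * bump e x y" for y
      using assms(1) bump_nonneg[of e x y] bump_ge_half[of e x y] by (auto simp: indicator_def)
    show "integrable M (indicat_real (ball x (e / 4)))"
      by (rule integrable_real_indicator) (auto simp: emeasure_eq_measure)
  qed (use integrable_bump[OF assms(1), of x] in simp)
  also have "\<dots> = 2 * bump_mass M e x"
    by (simp add: bump_mass_def)
  finally have "C ^ 3 * measure M (ball x (e / 4)) \<le> C ^ 3 * (2 * bump_mass M e x)"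
    using C_ge_1 by (intro mult_left_mono) auto
  with 1 show ?thesis by simp
qed

lemma bump_mass_pos: "0 < e \<Longrightarrow> 0 < bump_mass M e x"
  using ball_le_bump_mass[of e x x] ball_pos[of e x] C_ge_1
  by (smt (verit, ccfv_SIG) dist_self half_gt_zero_iff mult_nonneg_nonpos zero_le_power)

text \<open>As the space is bounded, \<open>2 ^ k * e\<close> exceeds its diameter for some
  \<open>k\<close> independent of the centre; \<open>k\<close> doublings then compare each ball of
  radius \<open>e\<close> with the whole space.\<close>

lemma ball_lower_bound:
  assumes "0 < e"
  obtains c where "0 < c" "\<And>x. c \<le> measure M (ball x e)"
proof -
  obtain a :: real where a: "\<And>x y :: 'a. dist x y \<le> a"
    using bounded_UNIV unfolding bounded_two_points by auto
  obtain k where k: "(a + 1) / e < 2 ^ k"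
    using real_arch_pow[of 2 "(a + 1) / e"] by auto
  have ball: "ball x (2 ^ k * e) = UNIV" for x :: 'a
  proof -
    have "dist x y < 2 ^ k * e" for y
      using a[of x y] k[unfolded pos_divide_less_eq[OF assms]] by linarith
    then show ?thesis by auto
  qed
  have "measure M UNIV \<le> C ^ k * measure M (ball x e)" for x
    using doubling_iterate[OF assms, of x k] by (simp add: ball)
  then have "measure M UNIV / C ^ k \<le> measure M (ball x e)" for x
    using C_ge_1 by (simp add: divide_le_eq mult.commute)
  moreover have "0 < measure M UNIV"
    using ball_pos[of "2 ^ k * e"] assms by (auto simp: ball)
  ultimately show ?thesis
    using that[of "measure M UNIV / C ^ k"] C_ge_1 by simp
qed

lemma bump_mass_lower_bound:
  assumes "0 < e"
  obtains c where "0 < c" "\<And>x. c \<le> bump_mass M e x"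
proof -
  obtain c where c: "0 < c" "\<And>x. c \<le> measure M (ball x e)"
    using ball_lower_bound[OF assms] by blast
  have "c / (2 * C ^ 3) \<le> bump_mass M e x" for x
    using order_trans[OF c(2)[of x] ball_le_bump_mass[OF assms, of x x]] assms C_ge_1
    by (simp add: divide_le_eq mult.commute)
  then show ?thesis
    using that[of "c / (2 * C ^ 3)"] c(1) C_ge_1 by simp
qed

section \<open>Pointwise and Lipschitz estimates for the mollification\<close>

lemma mollify_minus_const:
  assumes "0 < e" "integrable M f"
  shows "(LINT y|M. bump e x y * (f y - c)) = bump_mass M e x * (mollify M e f x - c)"
proof -
  have "(LINT y|M. bump e x y * (f y - c)) = (LINT y|M. bump e x y * f y) - (LINT y|M. bump e x y * c)"
    using assms unfolding right_diff_distrib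
    by (intro Bochner_Integration.integral_diff integrable_bump_mult) auto
  also have "(LINT y|M. bump e x y * f y) = bump_mass M e x * mollify M e f x"
    using bump_mass_pos[OF assms(1), of x] by (simp add: mollify_def)
  also have "(LINT y|M. bump e x y * c) = bump_mass M e x * c"
    by (simp add: bump_mass_def)
  finally show ?thesis
    by (simp only: right_diff_distrib)
qed

text \<open>For the constant \<open>c = mollify M e f x0\<close> the integral of
  \<open>bump e x0 y * (f y - c)\<close> vanishes. It may therefore be subtracted from the
  corresponding integral at \<open>x\<close>, leaving only the difference of the kernels.\<close>

lemma mollify_diff:
  assumes "0 < e" "integrable M f"
  shows "bump_mass M e x * \<bar>mollify M e f x - mollify M e f x0\<bar>
    \<le> (LINT y|M. \<bar>bump e x y - bump e x0 y\<bar> * \<bar>f y - mollify M e f x0\<bar>)"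
proof -
  let ?c = "mollify M e f x0"
  have i: "integrable M (\<lambda>y. bump e z y * (f y - ?c))" for z
    using assms by (intro integrable_bump_mult) auto
  have "bump_mass M e x * (mollify M e f x - ?c)
      = (LINT y|M. bump e x y * (f y - ?c)) - (LINT y|M. bump e x0 y * (f y - ?c))"
    using assms by (simp add: mollify_minus_const)
  also have "\<dots> = (LINT y|M. (bump e x y - bump e x0 y) * (f y - ?c))"
    using i by (simp add: left_diff_distrib)
  finally have "\<bar>bump_mass M e x * (mollify M e f x - ?c)\<bar>
      \<le> (LINT y|M. \<bar>(bump e x y - bump e x0 y) * (f y - ?c)\<bar>)"
    using integral_abs_bound[of M "\<lambda>y. (bump e x y - bump e x0 y) * (f y - ?c)"] by simp
  then show ?thesis
    using bump_mass_pos[OF assms(1), of x] by (simp add: abs_mult)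
qed

lemma integral_ball: "(LINT y:ball x e|M. g y) = measure M (ball x e) * ball_average M x e g" if "0 < e"
  using ball_pos[OF that, of x] by (simp add: ball_average_def)

lemma set_integrable_ball:
  fixes g :: "'a \<Rightarrow> real"
  shows "integrable M g \<Longrightarrow> set_integrable M (ball x e) g"
  unfolding set_integrable_def by (rule Bochner_Integration.integrable_mult_indicator[OF sets_ball])

lemma ball_average_mono:
  assumes "0 < e" "integrable M g" "integrable M h" "\<And>y. g y \<le> h y"
  shows "ball_average M x e g \<le> ball_average M x e h"
  unfolding ball_average_def using assms
  by (intro mult_left_mono set_integral_mono set_integrable_ball) auto

lemma ball_osc_nonneg: "0 \<le> ball_osc M e f x"
  unfolding ball_osc_def ball_average_def set_lebesgue_integral_def by simp

text \<open>The left side is a bump average of \<open>f y - f x\<close>; the bump is at most the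
  indicator of the ball, and its mass is comparable to that of the ball.\<close>

lemma mollify_close:
  assumes "0 < e" "integrable M f"
  shows "\<bar>mollify M e f x - f x\<bar> \<le> 2 * C ^ 3 * ball_osc M e f x"
proof -
  have "bump_mass M e x * \<bar>mollify M e f x - f x\<bar> = \<bar>LINT y|M. bump e x y * (f y - f x)\<bar>"
    using mollify_minus_const[OF assms, of x "f x"] bump_mass_pos[OF assms(1), of x] by (simp add: abs_mult)
  also have "\<dots> \<le> (LINT y|M. \<bar>bump e x y * (f y - f x)\<bar>)"
    by (rule integral_abs_bound)
  also have "\<dots> \<le> (LINT y:ball x e|M. \<bar>f y - f x\<bar>)"
    unfolding set_lebesgue_integral_def
  proof (intro integral_mono integrable_abs integrable_bump_mult assms(1))
    show "integrable M (\<lambda>y. indicat_real (ball x e) y *\<^sub>R \<bar>f y - f x\<bar>)"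
      using set_integrable_ball[of "\<lambda>y. \<bar>f y - f x\<bar>" x e] assms by (simp add: set_integrable_def)
    show "\<bar>bump e x y * (f y - f x)\<bar> \<le> indicat_real (ball x e) y *\<^sub>R \<bar>f y - f x\<bar>" for y
      using assms(1) bump_nonneg[of e x y] bump_le_1[of e x y] bump_eq_0[of e x y]
      by (cases "y \<in> ball x e") (auto simp: abs_mult mult_left_le_one_le)
  qed (use assms in simp)
  also have "\<dots> = measure M (ball x e) * ball_osc M e f x"
    using assms by (simp add: integral_ball ball_osc_def)
  also have "\<dots> \<le> (2 * C ^ 3 * bump_mass M e x) * ball_osc M e f x"
    using assms by (intro mult_right_mono ball_le_bump_mass ball_osc_nonneg) auto
  finally have "bump_mass M e x * \<bar>mollify M e f x - f x\<bar> \<le> bump_mass M e x * (2 * C ^ 3 * ball_osc M e f x)"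
    by (simp add: mult_ac)
  then show ?thesis
    using bump_mass_pos[OF assms(1), of x] by simp
qed

text \<open>The two kernels differ by at most \<open>2 * dist x x0 / e\<close>, and for
  \<open>dist x x0 \<le> e / 2\<close> both vanish outside \<open>ball x0 e\<close>. Replacing
  \<open>mollify M e f x0\<close> by \<open>f x0\<close> inside the integral costs one use of
  \<open>mollify_close\<close>. Only the oscillation at \<open>x0\<close> enters, so the bound
  passes to the pointwise Lipschitz constant at \<open>x0\<close>.\<close>

lemma mollify_locally_lipschitz:
  assumes "0 < e" "integrable M f" "dist x x0 \<le> e / 2"
  shows "\<bar>mollify M e f x - mollify M e f x0\<bar>
    \<le> dist x x0 * (4 * C ^ 3 * (1 + 2 * C ^ 3) / e * ball_osc M e f x0)"
proof -
  let ?c = "mollify M e f x0" and ?d = "2 * dist x x0 / e"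
  have fi: "integrable M (\<lambda>y. \<bar>f y - a\<bar>)" for a
    using assms by simp
  have "bump_mass M e x * \<bar>mollify M e f x - ?c\<bar>
      \<le> (LINT y|M. \<bar>bump e x y - bump e x0 y\<bar> * \<bar>f y - ?c\<bar>)"
    by (rule mollify_diff[OF assms(1,2)])
  also have "\<dots> \<le> (LINT y|M. ?d * (indicator (ball x0 e) y *\<^sub>R \<bar>f y - ?c\<bar>))"
  proof (rule integral_mono)
    \<comment> \<open>The integrand is the absolute value of a difference of two integrable bump
      multiples of \<open>f y - ?c\<close>.\<close>
    show "integrable M (\<lambda>y. \<bar>bump e x y - bump e x0 y\<bar> * \<bar>f y - ?c\<bar>)"
      using Bochner_Integration.integrable_diff[OF integrable_bump_mult[of e "\<lambda>y. f y - ?c" x] integrable_bump_mult[of e "\<lambda>y. f y - ?c" x0]]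
        assms by (auto simp: abs_mult simp flip: left_diff_distrib dest: integrable_abs)
    show "integrable M (\<lambda>y. ?d * (indicat_real (ball x0 e) y *\<^sub>R \<bar>f y - ?c\<bar>))"
      using set_integrable_ball[OF fi, of x0 e] by (simp add: set_integrable_def)
    fix y
    show "\<bar>bump e x y - bump e x0 y\<bar> * \<bar>f y - ?c\<bar> \<le> ?d * (indicator (ball x0 e) y *\<^sub>R \<bar>f y - ?c\<bar>)"
    proof (cases "y \<in> ball x0 e")
      case True
      then show ?thesis
        using mult_right_mono[OF bump_lipschitz[OF assms(1), of x y x0], of "\<bar>f y - ?c\<bar>"] by simp
    next
      case False
      then have "e / 2 \<le> dist x0 y" "e / 2 \<le> dist x y"
        using assms dist_triangle[of x0 y x] by (auto simp: dist_commute)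
      then show ?thesis
        using assms(1) by (simp add: bump_eq_0)
    qed
  qed
  also have "\<dots> = ?d * (LINT y:ball x0 e|M. \<bar>f y - ?c\<bar>)"
    by (simp add: set_lebesgue_integral_def)
  finally have *: "bump_mass M e x * \<bar>mollify M e f x - ?c\<bar> \<le> ?d * (LINT y:ball x0 e|M. \<bar>f y - ?c\<bar>)" .
  have "(LINT y:ball x0 e|M. \<bar>f y - ?c\<bar>) \<le> (LINT y:ball x0 e|M. \<bar>f y - f x0\<bar> + \<bar>f x0 - ?c\<bar>)"
    using fi by (intro set_integral_mono set_integrable_ball integrable_add) auto
  also have "\<dots> = measure M (ball x0 e) * (ball_osc M e f x0 + \<bar>f x0 - ?c\<bar>)"
    using set_integral_add(2)[OF set_integrable_ball[OF fi] set_integrable_ball[OF integrable_const], of x0 e "f x0" "\<bar>f x0 - ?c\<bar>"]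
      integral_ball[OF assms(1), of x0 "\<lambda>y. \<bar>f y - f x0\<bar>"]
    by (simp add: ball_osc_def distrib_left set_integral_const)
  also have "\<dots> \<le> (2 * C ^ 3 * bump_mass M e x) * (ball_osc M e f x0 + 2 * C ^ 3 * ball_osc M e f x0)"
    using assms mollify_close[OF assms(1,2), of x0] ball_osc_nonneg[of e f x0]
      bump_mass_pos[OF assms(1), of x] C_ge_1
    by (intro mult_mono ball_le_bump_mass add_left_mono) auto
  finally have "?d * (LINT y:ball x0 e|M. \<bar>f y - ?c\<bar>)
      \<le> ?d * ((2 * C ^ 3 * bump_mass M e x) * (ball_osc M e f x0 + 2 * C ^ 3 * ball_osc M e f x0))"
    using assms(1) by (intro mult_left_mono) auto
  also have "\<dots> = bump_mass M e x * (dist x x0 * (4 * C ^ 3 * (1 + 2 * C ^ 3) / e * ball_osc M e f x0))"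
    by (simp add: algebra_simps add_divide_distrib)
  finally have "bump_mass M e x * \<bar>mollify M e f x - ?c\<bar>
      \<le> bump_mass M e x * (dist x x0 * (4 * C ^ 3 * (1 + 2 * C ^ 3) / e * ball_osc M e f x0))"
    using * by simp
  then show ?thesis
    using bump_mass_pos[OF assms(1), of x] by (simp only: mult_le_cancel_left_pos)
qed

text \<open>A qualitative statement that makes the Poincare inequality applicable; the constant may
  depend on \<open>e\<close> and \<open>f\<close>. The lower bound on the bump mass bounds the
  mollification and then its difference quotients.\<close>

lemma mollify_lipschitz:
  assumes "0 < e" "integrable M f"
  shows "\<exists>L. L-lipschitz_on UNIV (mollify M e f)"
proof -
  obtain c where c: "0 < c" "\<And>x. c \<le> bump_mass M e x"
    using bump_mass_lower_bound[OF assms(1)] by blast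
  define I where "I = (LINT y|M. \<bar>f y\<bar>)"
  define m where "m = measure M UNIV"
  have bdd: "\<bar>mollify M e f x\<bar> \<le> I / c" for x
  proof -
    have "\<bar>LINT y|M. bump e x y * f y\<bar> \<le> (LINT y|M. \<bar>bump e x y * f y\<bar>)"
      by (rule integral_abs_bound)
    also have "\<dots> \<le> I"
      unfolding I_def using assms bump_nonneg[of e x] bump_le_1[OF assms(1), of x]
      by (intro integral_mono integrable_abs integrable_bump_mult) (auto simp: abs_mult mult_left_le_one_le)
    finally show ?thesis
      using c(1) c(2)[of x] unfolding mollify_def abs_divide
      by (intro frac_le) auto
  qed
  have "\<bar>mollify M e f x - mollify M e f x0\<bar> \<le> (2 / e * (I + I / c * m)) / c * dist x x0" for x x0
  proof -
    let ?c = "mollify M e f x0"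
    have "c * \<bar>mollify M e f x - ?c\<bar> \<le> bump_mass M e x * \<bar>mollify M e f x - ?c\<bar>"
      using c by (intro mult_right_mono) auto
    also have "\<dots> \<le> (LINT y|M. \<bar>bump e x y - bump e x0 y\<bar> * \<bar>f y - ?c\<bar>)"
      by (rule mollify_diff[OF assms])
    also have "\<dots> \<le> (LINT y|M. (2 * dist x x0 / e) * (\<bar>f y\<bar> + I / c))"
    proof (rule integral_mono)
      show "integrable M (\<lambda>y. \<bar>bump e x y - bump e x0 y\<bar> * \<bar>f y - ?c\<bar>)"
        using Bochner_Integration.integrable_diff[OF integrable_bump_mult[of e "\<lambda>y. f y - ?c" x] integrable_bump_mult[of e "\<lambda>y. f y - ?c" x0]]
          assms by (auto simp: abs_mult simp flip: left_diff_distrib dest: integrable_abs)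
      show "\<bar>bump e x y - bump e x0 y\<bar> * \<bar>f y - ?c\<bar> \<le> (2 * dist x x0 / e) * (\<bar>f y\<bar> + I / c)" for y
        using bump_lipschitz[OF assms(1), of x y x0] bdd[of x0] assms(1) abs_triangle_ineq4[of "f y" ?c]
        by (intro mult_mono) auto
    qed (use assms in simp)
    also have "\<dots> = (2 * dist x x0 / e) * (I + I / c * m)"
      using assms by (simp add: I_def m_def space_M)
    finally show ?thesis
      using c(1) assms(1) by (simp add: field_simps)
  qed
  moreover have "0 \<le> (2 / e * (I + I / c * m)) / c"
    using c(1) assms(1) by (simp add: I_def m_def)
  ultimately show ?thesis
    by (auto simp: lipschitz_on_def dist_real_def intro!: exI[of _ "(2 / e * (I + I / c * m)) / c"])
qed

text \<open>For radii below \<open>e / 2\<close> the local estimate bounds every quotient in the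
  limsup by the same constant.\<close>

lemma pointwise_Lip_mollify:
  assumes "0 < e" "integrable M f"
  shows "pointwise_Lip (mollify M e f) x \<le> ennreal (4 * C ^ 3 * (1 + 2 * C ^ 3) / e * ball_osc M e f x)"
    (is "_ \<le> ennreal ?K")
proof -
  have K: "0 \<le> ?K"
    using assms(1) C_ge_1 ball_osc_nonneg[of e f x] by simp
  have "\<forall>\<^sub>F r in at_right 0. (SUP z\<in>cball x r. ennreal (\<bar>mollify M e f z - mollify M e f x\<bar> / r)) \<le> ennreal ?K"
  proof (rule eventually_at_rightI)
    fix r assume r: "r \<in> {0<..<e / 2}"
    have "\<bar>mollify M e f z - mollify M e f x\<bar> / r \<le> ?K" if "z \<in> cball x r" for z
    proof -
      have z: "dist z x \<le> r" using that by (simp add: dist_commute)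
      have "\<bar>mollify M e f z - mollify M e f x\<bar> \<le> dist z x * ?K"
        using z r by (intro mollify_locally_lipschitz assms) auto
      also have "\<dots> \<le> r * ?K"
        using z K by (rule mult_right_mono)
      finally show ?thesis
        using r by (simp add: divide_le_eq mult.commute)
    qed
    then show "(SUP z\<in>cball x r. ennreal (\<bar>mollify M e f z - mollify M e f x\<bar> / r)) \<le> ennreal ?K"
      by (intro SUP_least ennreal_leI)
  qed (use assms in simp)
  then show ?thesis
    unfolding pointwise_Lip_def by (rule Limsup_bounded)
qed

text \<open>Jensen's inequality for the average over the ball, up to the factor
  \<open>2 powr p\<close>. Integrating the right side in \<open>x\<close> produces the
  energy.\<close>

lemma ball_osc_powr_le:
  assumes p: "1 \<le> p" and e: "0 < e" and f: "f \<in> Lp_funs p M"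
  shows "ennreal (ball_osc M e f x powr p) \<le> ennreal (2 powr p) *
    ((1 / emeasure M (ball x e)) * (\<integral>\<^sup>+ y\<in>ball x e. ennreal (\<bar>f y - f x\<bar> powr p) \<partial>M))"
proof -
  have [measurable]: "f \<in> borel_measurable M" and fp: "integrable M (\<lambda>x. \<bar>f x\<bar> powr p)"
    using f by (auto simp: Lp_funs_def)
  have fi: "integrable M (\<lambda>y. \<bar>f y - f x\<bar>)"
    using integrable_of_integrable_powr[OF p _ fp] by simp
  have fpi: "integrable M (\<lambda>y. \<bar>f y - f x\<bar> powr p)"
    using p fp by (intro integrable_powr_diff) auto
  let ?a = "ball_osc M e f x" and ?b = "ball_average M x e (\<lambda>y. \<bar>f y - f x\<bar> powr p)"
  have m: "0 < measure M (ball x e)" by (rule ball_pos[OF e])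
  have b: "0 \<le> ?b"
    unfolding ball_average_def set_lebesgue_integral_def by simp
  have "?a powr p \<le> 2 powr p * ?b"
  proof (cases "?a = 0")
    case True
    then show ?thesis using b by simp
  next
    case False
    \<comment> \<open>With \<open>\<eta>\<close> half of the average, \<open>le_add_powr\<close>
      gives \<open>2 * \<eta> \<le> \<eta> + \<eta> powr (1 - p) * ?b\<close>. One
      \<open>\<eta>\<close> is absorbed on the left, and multiplying by
      \<open>\<eta> powr (p - 1)\<close> leaves \<open>\<eta> powr p \<le> ?b\<close>.\<close>
    define \<eta> where "\<eta> = ?a / 2"
    have \<eta>: "0 < \<eta>" "?a = 2 * \<eta>"
      using False ball_osc_nonneg[of e f x] by (auto simp: \<eta>_def)
    have "?a \<le> ball_average M x e (\<lambda>y. \<eta> + \<eta> powr (1 - p) * \<bar>f y - f x\<bar> powr p)"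
      unfolding ball_osc_def using fi fpi le_add_powr[OF \<eta>(1) _ p] e
      by (intro ball_average_mono) auto
    also have "\<dots> = \<eta> + \<eta> powr (1 - p) * ?b"
      using set_integral_add(2)[OF set_integrable_ball[OF integrable_const] set_integrable_ball[OF integrable_mult_right[OF fpi]],
          of x e \<eta> "\<eta> powr (1 - p)"] m
      by (simp add: ball_average_def set_integral_const field_simps)
    finally have "\<eta> \<le> \<eta> powr (1 - p) * ?b"
      using \<eta> by simp
    then have "\<eta> powr (p - 1) * \<eta> \<le> \<eta> powr (p - 1) * (\<eta> powr (1 - p) * ?b)"
      by (rule mult_left_mono) simp
    also have "\<dots> = ?b"
      using \<eta>(1) by (simp flip: mult.assoc powr_add)
    also have "\<eta> powr (p - 1) * \<eta> = \<eta> powr p"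
      using \<eta>(1) by (simp add: powr_diff)
    finally show ?thesis
      using \<eta>(1) unfolding \<eta>(2) by (simp add: powr_mult)
  qed
  then have "ennreal (?a powr p) \<le> ennreal (2 powr p) * ennreal ?b"
    by (simp add: b flip: ennreal_mult)
  also have "ennreal ?b = (1 / emeasure M (ball x e)) * (\<integral>\<^sup>+ y\<in>ball x e. ennreal (\<bar>f y - f x\<bar> powr p) \<partial>M)"
  proof -
    have "(\<integral>\<^sup>+ y\<in>ball x e. ennreal (\<bar>f y - f x\<bar> powr p) \<partial>M)
        = (\<integral>\<^sup>+ y. ennreal (indicator (ball x e) y *\<^sub>R \<bar>f y - f x\<bar> powr p) \<partial>M)"
      by (intro nn_integral_cong) (auto simp: indicator_def)
    also have "\<dots> = ennreal (LINT y:ball x e|M. \<bar>f y - f x\<bar> powr p)"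
      unfolding set_lebesgue_integral_def using set_integrable_ball[OF fpi, of x e]
      by (intro nn_integral_eq_integral) (auto simp: set_integrable_def)
    finally have *: "(\<integral>\<^sup>+ y\<in>ball x e. ennreal (\<bar>f y - f x\<bar> powr p) \<partial>M)
        = ennreal (LINT y:ball x e|M. \<bar>f y - f x\<bar> powr p)" .
    have "0 \<le> (LINT y:ball x e|M. \<bar>f y - f x\<bar> powr p)"
      by (simp add: set_lebesgue_integral_def)
    moreover have "1 / emeasure M (ball x e) = ennreal (1 / measure M (ball x e))"
      using m divide_ennreal[of 1 "measure M (ball x e)"] by (simp add: emeasure_eq_measure)
    ultimately show ?thesis
      unfolding * ball_average_def by (simp only: ennreal_mult divide_nonneg_nonneg zero_le_one measure_nonneg)
  qed
  finally show ?thesis .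
qed

lemma nn_integral_ball_osc_le:
  assumes "1 \<le> p" "0 < e" "f \<in> Lp_funs p M"
  shows "(\<integral>\<^sup>+ x. ennreal (ball_osc M e f x powr p) \<partial>M) \<le> ennreal (2 powr p * e powr p) * KS_energy p M e f"
proof -
  have "(\<integral>\<^sup>+ x. ennreal (ball_osc M e f x powr p) \<partial>M) \<le> (\<integral>\<^sup>+ x. ennreal (2 powr p) *
    ((1 / emeasure M (ball x e)) * (\<integral>\<^sup>+ y\<in>ball x e. ennreal (\<bar>f y - f x\<bar> powr p) \<partial>M)) \<partial>M)"
    using assms by (intro nn_integral_mono ball_osc_powr_le)
  also have "\<dots> \<le> ennreal (2 powr p) * (\<integral>\<^sup>+ x. (1 / emeasure M (ball x e)) *
      (\<integral>\<^sup>+ y\<in>ball x e. ennreal (\<bar>f y - f x\<bar> powr p) \<partial>M) \<partial>M)"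
    by (rule nn_integral_cmult_le) simp
  also have "\<dots> = ennreal (2 powr p * e powr p) * KS_energy p M e f"
  proof -
    have "ennreal (2 powr p * e powr p) * (ennreal (1 / e powr p) * z) = ennreal (2 powr p) * z" for z
      using assms(2) by (simp flip: mult.assoc ennreal_mult)
    then show ?thesis by (simp add: KS_energy_def)
  qed
  finally show ?thesis .
qed

text \<open>\<open>B\<close> depends neither on the scale nor on the function. The first bound keeps
  the factor \<open>e powr p\<close> from the oscillation integral; in the second it cancels against
  the \<open>1 / e\<close> in the Lipschitz estimate.\<close>

lemma mollify_bounds:
  assumes p: "1 \<le> p"
  shows "\<exists>B>0. \<forall>e f. 0 < e \<longrightarrow> f \<in> Lp_funs p M \<longrightarrow>
      (\<integral>\<^sup>+ x. ennreal (\<bar>f x - mollify M e f x\<bar> powr p) \<partial>M) \<le> ennreal (B * e powr p) * KS_energy p M e f \<and>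
      (\<integral>\<^sup>+ x. ennreal_powr (pointwise_Lip (mollify M e f) x) p \<partial>M) \<le> ennreal B * KS_energy p M e f"
proof -
  \<comment> \<open>\<open>K1\<close> and \<open>K2\<close> are the constants of
    \<open>mollify_close\<close> and \<open>pointwise_Lip_mollify\<close>; the larger one,
    \<open>K2\<close>, serves for both bounds.\<close>
  define K1 where "K1 = 2 * C ^ 3"
  define K2 where "K2 = 4 * C ^ 3 * (1 + 2 * C ^ 3)"
  have K: "0 < K1" "K1 \<le> K2"
    using C_ge_1 by (auto simp: K1_def K2_def)
  define B where "B = K2 powr p * 2 powr p"
  have B: "0 < B"
    using K by (simp add: B_def)
  have osc: "(\<integral>\<^sup>+ x. ennreal (k powr p * ball_osc M e f x powr p) \<partial>M)
      \<le> ennreal (k powr p * (2 powr p * e powr p)) * KS_energy p M e f"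
    if "0 < e" "f \<in> Lp_funs p M" "0 < k" for e f k
  proof -
    have "(\<integral>\<^sup>+ x. ennreal (k powr p * ball_osc M e f x powr p) \<partial>M)
        \<le> ennreal (k powr p) * (\<integral>\<^sup>+ x. ennreal (ball_osc M e f x powr p) \<partial>M)"
      using that nn_integral_cmult_le[of "k powr p" M "\<lambda>x. ennreal (ball_osc M e f x powr p)"]
      by (simp add: ennreal_mult)
    also have "\<dots> \<le> ennreal (k powr p) * (ennreal (2 powr p * e powr p) * KS_energy p M e f)"
      using nn_integral_ball_osc_le[OF p that(1,2)] by (rule mult_left_mono) simp
    finally show ?thesis
      by (simp add: ennreal_mult mult.assoc)
  qed
  have int: "integrable M f" if "f \<in> Lp_funs p M" for f
    using that integrable_of_integrable_powr[OF p, of f] unfolding Lp_funs_def by blast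
  show ?thesis
  proof (intro exI[of _ B] conjI allI impI B)
    fix e :: real and f assume e: "0 < e" and f: "f \<in> Lp_funs p M"
    have "(\<integral>\<^sup>+ x. ennreal (\<bar>f x - mollify M e f x\<bar> powr p) \<partial>M)
        \<le> (\<integral>\<^sup>+ x. ennreal (K2 powr p * ball_osc M e f x powr p) \<partial>M)"
    proof (intro nn_integral_mono ennreal_leI)
      fix x
      have "\<bar>f x - mollify M e f x\<bar> \<le> K1 * ball_osc M e f x"
        using mollify_close[OF e int[OF f], of x] by (simp add: K1_def abs_minus_commute)
      also have "\<dots> \<le> K2 * ball_osc M e f x"
        using K ball_osc_nonneg by (intro mult_right_mono) auto
      finally have "\<bar>f x - mollify M e f x\<bar> powr p \<le> (K2 * ball_osc M e f x) powr p"
        using p by (intro powr_mono2) auto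
      then show "\<bar>f x - mollify M e f x\<bar> powr p \<le> K2 powr p * ball_osc M e f x powr p"
        using K ball_osc_nonneg[of e f x] by (simp add: powr_mult)
    qed
    also have "\<dots> \<le> ennreal (B * e powr p) * KS_energy p M e f"
      using osc[OF e f, of K2] K by (simp add: B_def mult.assoc)
    finally show "(\<integral>\<^sup>+ x. ennreal (\<bar>f x - mollify M e f x\<bar> powr p) \<partial>M)
        \<le> ennreal (B * e powr p) * KS_energy p M e f" .
    have "(\<integral>\<^sup>+ x. ennreal_powr (pointwise_Lip (mollify M e f) x) p \<partial>M)
        \<le> (\<integral>\<^sup>+ x. ennreal ((K2 / e) powr p * ball_osc M e f x powr p) \<partial>M)"
    proof (intro nn_integral_mono)
      fix x
      let ?l = "pointwise_Lip (mollify M e f) x"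
      have l: "?l \<le> ennreal (K2 / e * ball_osc M e f x)"
        using pointwise_Lip_mollify[OF e int[OF f], of x] by (simp add: K2_def)
      moreover have nn: "0 \<le> K2 / e * ball_osc M e f x"
        using K e ball_osc_nonneg[of e f x] by simp
      ultimately have "enn2real ?l \<le> K2 / e * ball_osc M e f x"
        by (intro enn2real_leI)
      then have "enn2real ?l powr p \<le> (K2 / e * ball_osc M e f x) powr p"
        using p by (intro powr_mono2) auto
      also have "\<dots> = (K2 / e) powr p * ball_osc M e f x powr p"
        by (rule powr_mult)
      finally show "ennreal_powr ?l p \<le> ennreal ((K2 / e) powr p * ball_osc M e f x powr p)"
        using l by (auto simp: ennreal_powr_def top_unique intro: ennreal_leI)
    qed
    also have "\<dots> \<le> ennreal ((K2 / e) powr p * (2 powr p * e powr p)) * KS_energy p M e f"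
      using osc[OF e f, of "K2 / e"] K e by simp
    also have "(K2 / e) powr p * (2 powr p * e powr p) = B"
      using K e by (simp add: B_def powr_divide)
    finally show "(\<integral>\<^sup>+ x. ennreal_powr (pointwise_Lip (mollify M e f) x) p \<partial>M) \<le> ennreal B * KS_energy p M e f" .
  qed
qed

section \<open>Total boundedness from the Poincare inequality\<close>

text \<open>Packing: the balls of radius \<open>R / 2\<close> about the points of \<open>S\<close>
  are disjoint and lie in \<open>ball x (2 * T)\<close>, while each carries at least the fraction
  \<open>1 / C ^ k\<close> of its mass, because \<open>3 * T \<le> 2 ^ k * (R / 2)\<close>.\<close>

lemma separated_card_le:
  fixes S :: "'a set"
  assumes R: "0 < R" "R \<le> T" "6 * T \<le> 2 ^ k * R"
    and S: "finite S" "S \<subseteq> ball x T" "pairwise (\<lambda>s t. R \<le> dist s t) S"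
  shows "real (card S) \<le> C ^ k"
proof -
  let ?m = "measure M (ball x (2 * T))"
  have "?m \<le> C ^ k * measure M (ball s (R / 2))" if "s \<in> S" for s
  proof -
    have "ball x (2 * T) \<subseteq> ball s (2 ^ k * (R / 2))"
    proof
      fix y assume "y \<in> ball x (2 * T)"
      moreover have "dist x s < T" using that S by auto
      ultimately show "y \<in> ball s (2 ^ k * (R / 2))"
        using dist_triangle[of s y x] R by (simp add: dist_commute)
    qed
    then have "?m \<le> measure M (ball s (2 ^ k * (R / 2)))"
      by (intro finite_measure_mono) auto
    also have "\<dots> \<le> C ^ k * measure M (ball s (R / 2))"
      using R by (intro doubling_iterate) simp
    finally show ?thesis .
  qed
  then have "real (card S) * ?m \<le> C ^ k * (\<Sum>s\<in>S. measure M (ball s (R / 2)))"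
    using sum_bounded_below[of S ?m "\<lambda>s. C ^ k * measure M (ball s (R / 2))"] by (simp add: sum_distrib_left)
  also have "(\<Sum>s\<in>S. measure M (ball s (R / 2))) = measure M (\<Union>s\<in>S. ball s (R / 2))"
  proof (rule finite_measure_finite_Union[symmetric])
    show "disjoint_family_on (\<lambda>s. ball s (R / 2)) S"
      unfolding disjoint_family_on_def
    proof (intro ballI impI)
      fix s t assume "s \<in> S" "t \<in> S" "s \<noteq> t"
      then have "R \<le> dist s t"
        using S(3) by (auto simp: pairwise_def)
      then show "ball s (R / 2) \<inter> ball t (R / 2) = {}"
        using dist_triangle_half_r[of _ s R t] by (fastforce simp: dist_commute)
    qed
  qed (use S in auto)
  also have "\<dots> \<le> ?m"
  proof (intro finite_measure_mono UN_least subsetI)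
    fix s y assume "s \<in> S" "y \<in> ball s (R / 2)"
    moreover have "dist x s < T" using \<open>s \<in> S\<close> S by auto
    ultimately show "y \<in> ball x (2 * T)"
      using dist_triangle[of x y s] R by (simp add: dist_commute)
  qed simp
  finally have "real (card S) * ?m \<le> C ^ k * ?m"
    using C_ge_1 by simp
  then show ?thesis
    using ball_pos[of "2 * T" x] R by simp
qed

text \<open>The packing bound allows a choice of an \<open>R\<close>-separated set of greatest
  cardinality. A point at distance at least \<open>R\<close> from all of it could be added.\<close>

lemma finite_net:
  assumes R: "0 < R"
  shows "\<exists>S :: 'a set. finite S \<and> pairwise (\<lambda>s t. R \<le> dist s t) S \<and> (\<forall>x. \<exists>s\<in>S. dist s x < R)"
proof -
  let ?P = "\<lambda>S :: 'a set. finite S \<and> pairwise (\<lambda>s t. R \<le> dist s t) S"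
  fix x :: 'a
  obtain T0 where T0: "\<And>y. dist x y < T0"
    using bounded_UNIV unfolding bounded_any_center[of _ x] by (meson UNIV_I gt_ex le_less_trans)
  \<comment> \<open>\<open>T0\<close> makes the ball the whole space; the maximum secures the
    condition \<open>R \<le> T\<close> of the packing bound.\<close>
  define T where "T = max T0 R"
  obtain k where k: "6 * T / R < 2 ^ k"
    using real_arch_pow[of 2 "6 * T / R"] by auto
  obtain b :: nat where b: "C ^ k < real b"
    using reals_Archimedean2 by blast
  have bound: "card S < b" if "?P S" for S
  proof -
    have "real (card S) \<le> C ^ k"
    proof (rule separated_card_le[OF R, of T])
      show "6 * T \<le> 2 ^ k * R"
        using k[unfolded pos_divide_less_eq[OF R]] by simp
      show "S \<subseteq> ball x T"
        using T0 by (auto simp: T_def less_max_iff_disj)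
    qed (use that in \<open>auto simp: T_def\<close>)
    then show ?thesis using b by linarith
  qed
  have "\<exists>S. ?P S \<and> (\<forall>S'. ?P S' \<longrightarrow> card S' \<le> card S)"
    by (rule ex_has_greatest_nat[of ?P "{}" card b]) (use bound in auto)
  then obtain S where S: "?P S" and max: "\<And>S'. ?P S' \<Longrightarrow> card S' \<le> card S"
    by blast
  show ?thesis
  proof (intro exI[of _ S] conjI allI)
    fix x
    show "\<exists>s\<in>S. dist s x < R"
    proof (rule ccontr)
      assume no: "\<not> (\<exists>s\<in>S. dist s x < R)"
      then have "?P (insert x S)"
        using S by (auto simp: pairwise_insert dist_commute not_less)
      moreover have "x \<notin> S"
        using no R by force
      ultimately show False
        using max[of "insert x S"] S by simp
    qed
  qed (use S in auto)
qed

text \<open>If \<open>ball s (\<Lambda> * R)\<close> contains \<open>y\<close>, then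
  \<open>s\<close> lies in \<open>ball y (\<Lambda> * R)\<close>, so by packing at most
  \<open>C ^ k\<close> of the dilated balls meet at a point. Here \<open>k\<close> depends only on
  \<open>\<Lambda>\<close>, whence \<open>N\<close> is independent of \<open>f\<close>,
  \<open>R\<close> and \<open>S\<close>.\<close>

lemma sum_poincare:
  assumes "0 < c" "1 \<le> \<Lambda>"
    and poincare: "\<And>f x R. \<exists>L. L-lipschitz_on UNIV f \<Longrightarrow> 0 < R \<Longrightarrow>
      (\<integral>\<^sup>+ y\<in>ball x R. ennreal (\<bar>f y - ball_average M x R f\<bar> powr p) \<partial>M)
        \<le> ennreal (c * R powr p) * (\<integral>\<^sup>+ y\<in>ball x (\<Lambda> * R). ennreal_powr (pointwise_Lip f y) p \<partial>M)"
  shows "\<exists>N>0. \<forall>f R S. (\<exists>L. L-lipschitz_on UNIV f) \<longrightarrow> 0 < R \<longrightarrow> finite S \<longrightarrow>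
      pairwise (\<lambda>s t. R \<le> dist s t) S \<longrightarrow>
      (\<Sum>s\<in>S. \<integral>\<^sup>+ y\<in>ball s R. ennreal (\<bar>f y - ball_average M s R f\<bar> powr p) \<partial>M)
        \<le> ennreal (N * R powr p) * (\<integral>\<^sup>+ y. ennreal_powr (pointwise_Lip f y) p \<partial>M)"
proof -
  obtain k where k: "6 * \<Lambda> < 2 ^ k"
    using real_arch_pow[of 2 "6 * \<Lambda>"] by auto
  have "0 < c * C ^ k"
    using assms C_ge_1 by simp
  then show ?thesis
  proof (intro exI[of _ "c * C ^ k"] conjI allI impI)
    fix f :: "'a \<Rightarrow> real" and R :: real and S :: "'a set"
    assume f: "\<exists>L. L-lipschitz_on UNIV f" and R: "0 < R"
      and S: "finite S" "pairwise (\<lambda>s t. R \<le> dist s t) S"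
    let ?g = "\<lambda>y. ennreal_powr (pointwise_Lip f y) p"
    have overlap: "(\<Sum>s\<in>S. indicator (ball s (\<Lambda> * R)) y) \<le> ennreal (C ^ k)" for y
    proof -
      let ?S = "{s \<in> S. y \<in> ball s (\<Lambda> * R)}"
      have "real (card ?S) \<le> C ^ k"
      proof (rule separated_card_le[OF R])
        show "R \<le> \<Lambda> * R" "6 * (\<Lambda> * R) \<le> 2 ^ k * R"
          using assms R k by (simp_all flip: mult.assoc)
        show "?S \<subseteq> ball y (\<Lambda> * R)"
          by (auto simp: dist_commute)
        show "pairwise (\<lambda>s t. R \<le> dist s t) ?S"
          using S(2) by (rule pairwise_subset) auto
      qed (use S in auto)
      moreover have "(\<Sum>s\<in>S. indicator (ball s (\<Lambda> * R)) y) = ennreal (real (card ?S))"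
        using S(1) by (simp add: indicator_def sum.If_cases Int_def ennreal_of_nat_eq_real_of_nat)
      ultimately show ?thesis
        by (simp add: ennreal_leI)
    qed
    have "(\<Sum>s\<in>S. \<integral>\<^sup>+ y\<in>ball s R. ennreal (\<bar>f y - ball_average M s R f\<bar> powr p) \<partial>M)
        \<le> (\<Sum>s\<in>S. ennreal (c * R powr p) * (\<integral>\<^sup>+ y\<in>ball s (\<Lambda> * R). ?g y \<partial>M))"
      by (intro sum_mono poincare f R)
    also have "\<dots> = ennreal (c * R powr p) * (\<Sum>s\<in>S. \<integral>\<^sup>+ y\<in>ball s (\<Lambda> * R). ?g y \<partial>M)"
      by (simp add: sum_distrib_left)
    finally have *: "(\<Sum>s\<in>S. \<integral>\<^sup>+ y\<in>ball s R. ennreal (\<bar>f y - ball_average M s R f\<bar> powr p) \<partial>M)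
        \<le> ennreal (c * R powr p) * (\<Sum>s\<in>S. \<integral>\<^sup>+ y\<in>ball s (\<Lambda> * R). ?g y \<partial>M)" .
    \<comment> \<open>Superadditivity of the lower integral is exactly the direction needed here, so
      the pointwise Lipschitz constant may stay without a measurability proof.\<close>
    have "(\<Sum>s\<in>S. \<integral>\<^sup>+ y\<in>ball s (\<Lambda> * R). ?g y \<partial>M)
        \<le> (\<integral>\<^sup>+ y. (\<Sum>s\<in>S. ?g y * indicator (ball s (\<Lambda> * R)) y) \<partial>M)"
      by (rule sum_nn_integral_le[OF S(1)])
    also have "\<dots> \<le> (\<integral>\<^sup>+ y. ennreal (C ^ k) * ?g y \<partial>M)"
      unfolding sum_distrib_left[symmetric] mult.commute[of "ennreal _"]
      by (intro nn_integral_mono mult_left_mono overlap) simp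
    also have "\<dots> \<le> ennreal (C ^ k) * (\<integral>\<^sup>+ y. ?g y \<partial>M)"
      using C_ge_1 by (intro nn_integral_cmult_le) simp
    finally have "ennreal (c * R powr p) * (\<Sum>s\<in>S. \<integral>\<^sup>+ y\<in>ball s (\<Lambda> * R). ?g y \<partial>M)
        \<le> ennreal (c * R powr p) * (ennreal (C ^ k) * (\<integral>\<^sup>+ y. ?g y \<partial>M))"
      by (rule mult_left_mono) simp
    with * show "(\<Sum>s\<in>S. \<integral>\<^sup>+ y\<in>ball s R. ennreal (\<bar>f y - ball_average M s R f\<bar> powr p) \<partial>M)
        \<le> ennreal (c * C ^ k * R powr p) * (\<integral>\<^sup>+ y. ?g y \<partial>M)"
      using assms(1) C_ge_1 by (simp add: ennreal_mult mult_ac)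
  qed
qed

text \<open>The integral of \<open>\<bar>u\<bar>\<close> is controlled through
  \<open>\<bar>u\<bar> \<le> 1 + \<bar>u\<bar> powr p\<close>, and the mass of the ball is bounded
  below. The bound is uniform in \<open>u\<close> and \<open>x\<close>, as the pigeonhole argument
  requires.\<close>

lemma ball_average_bounded:
  assumes p: "1 \<le> p" and R: "0 < R"
  shows "\<exists>b. \<forall>u x. u \<in> borel_measurable M \<longrightarrow>
    (\<integral>\<^sup>+ y. ennreal (\<bar>u y\<bar> powr p) \<partial>M) \<le> ennreal A \<longrightarrow> \<bar>ball_average M x R u\<bar> \<le> b"
proof -
  obtain c where c: "0 < c" "\<And>x. c \<le> measure M (ball x R)"
    using ball_lower_bound[OF R] by blast
  show ?thesis
  proof (intro exI allI impI)
    fix u :: "'a \<Rightarrow> real" and x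
    assume u[measurable]: "u \<in> borel_measurable M" and A: "(\<integral>\<^sup>+ y. ennreal (\<bar>u y\<bar> powr p) \<partial>M) \<le> ennreal A"
    have up: "integrable M (\<lambda>y. \<bar>u y\<bar> powr p)"
      using le_less_trans[OF A] by (intro integrableI_bounded) auto
    have ui: "integrable M u"
      using integrable_of_integrable_powr[OF p u up] .
    \<comment> \<open>The sign of \<open>A\<close> is not fixed, so \<open>\<bar>A\<bar>\<close> is
      used to return from \<open>ennreal\<close> to reals.\<close>
    have "ennreal (LINT y|M. \<bar>u y\<bar> powr p) \<le> ennreal \<bar>A\<bar>"
      using order_trans[OF A ennreal_leI[OF abs_ge_self]] up by (simp add: nn_integral_eq_integral)
    then have A': "(LINT y|M. \<bar>u y\<bar> powr p) \<le> \<bar>A\<bar>"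
      by (simp add: ennreal_le_iff)
    have "\<bar>LINT y:ball x R|M. u y\<bar> \<le> (LINT y|M. \<bar>indicator (ball x R) y *\<^sub>R u y\<bar>)"
      unfolding set_lebesgue_integral_def by (rule integral_abs_bound)
    also have "\<dots> \<le> (LINT y|M. 1 + \<bar>u y\<bar> powr p)"
    proof (rule integral_mono)
      show "integrable M (\<lambda>y. \<bar>indicat_real (ball x R) y *\<^sub>R u y\<bar>)"
        using set_integrable_ball[OF ui, of x R] unfolding set_integrable_def by (rule integrable_abs)
      show "\<bar>indicat_real (ball x R) y *\<^sub>R u y\<bar> \<le> 1 + \<bar>u y\<bar> powr p" for y
        using le_add_powr[of 1 "\<bar>u y\<bar>" p] p by (auto simp: indicator_def)
    qed (use up in simp)
    also have "\<dots> = measure M UNIV + (LINT y|M. \<bar>u y\<bar> powr p)"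
      using up by (simp add: space_M)
    finally have "\<bar>LINT y:ball x R|M. u y\<bar> \<le> measure M UNIV + \<bar>A\<bar>"
      using A' by simp
    moreover have "0 \<le> measure M UNIV + \<bar>A\<bar>" by simp
    ultimately have "\<bar>LINT y:ball x R|M. u y\<bar> / measure M (ball x R) \<le> (measure M UNIV + \<bar>A\<bar>) / c"
      using c by (intro frac_le) auto
    then show "\<bar>ball_average M x R u\<bar> \<le> (measure M UNIV + \<bar>A\<bar>) / c"
      by (simp add: ball_average_def abs_mult)
  qed
qed

text \<open>Total boundedness at one level \<delta>. On the balls of a net, Poincare replaces each
  function by its averages with small error; the averages are finitely many bounded numbers, and
  infinitely many indices share the same rounded values.\<close>

lemma small_oscillation_subseq:
  fixes u :: "nat \<Rightarrow> 'a \<Rightarrow> real"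
  assumes p: "1 \<le> p" and \<delta>: "0 < \<delta>" and N: "0 < N" and A: "0 < A"
    and sum_poincare: "\<And>f R S. \<exists>L. L-lipschitz_on UNIV f \<Longrightarrow> 0 < R \<Longrightarrow> finite S \<Longrightarrow>
      pairwise (\<lambda>s t. R \<le> dist s t) S \<Longrightarrow>
      (\<Sum>s\<in>S. \<integral>\<^sup>+ y\<in>ball s R. ennreal (\<bar>f y - ball_average M s R f\<bar> powr p) \<partial>M)
        \<le> ennreal (N * R powr p) * (\<integral>\<^sup>+ y. ennreal_powr (pointwise_Lip f y) p \<partial>M)"
    and lip: "\<And>n. \<exists>L. L-lipschitz_on UNIV (u n)"
    and bdd: "\<And>n. (\<integral>\<^sup>+ y. ennreal (\<bar>u n y\<bar> powr p) \<partial>M) \<le> ennreal A"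
    and Lip: "\<And>n. (\<integral>\<^sup>+ y. ennreal_powr (pointwise_Lip (u n) y) p \<partial>M) \<le> ennreal A"
  shows "\<exists>r. strict_mono (r :: nat \<Rightarrow> nat) \<and>
    (\<forall>i j. (\<integral>\<^sup>+ y. ennreal (\<bar>u (r i) y - u (r j) y\<bar> powr p) \<partial>M) \<le> ennreal \<delta>)"
proof -
  have um[measurable]: "u n \<in> borel_measurable M" for n
    using lip[of n] lipschitz_on_continuous_on by (intro measurable_continuous) blast
  \<comment> \<open>Chosen so that \<open>4 powr p * (N * R powr p * A) = \<delta> / 4\<close>; the
    oscillations of the two compared functions then contribute \<open>\<delta> / 2\<close>
    together.\<close>
  define R where "R = (\<delta> / (4 * 4 powr p * (N * A))) powr (1 / p)"
  have R: "0 < R" "R powr p = \<delta> / (4 * 4 powr p * (N * A))"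
    using p \<delta> N A by (auto simp: R_def powr_powr)
  obtain S :: "'a set" where net: "finite S \<and> pairwise (\<lambda>s t. R \<le> dist s t) S \<and> (\<forall>x. \<exists>s\<in>S. dist s x < R)"
    using finite_net[OF R(1)] ..
  note S = net[THEN conjunct1] net[THEN conjunct2, THEN conjunct1] net[THEN conjunct2, THEN conjunct2, THEN spec]
  define m where "m = real (card S) * measure M UNIV"
  \<comment> \<open>The mesh of the rounding, chosen so that the averages contribute at most
    \<open>\<delta> / 2\<close>; \<open>m + 1\<close> in place of \<open>m\<close> keeps the
    denominator positive.\<close>
  define \<eta> where "\<eta> = (\<delta> / (2 * 4 powr p * (m + 1))) powr (1 / p)"
  have m: "0 \<le> m" by (simp add: m_def)
  have \<eta>: "0 < \<eta>" "\<eta> powr p = \<delta> / (2 * 4 powr p * (m + 1))"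
    using p \<delta> m by (auto simp: \<eta>_def powr_powr)
  define a where "a n s = ball_average M s R (u n)" for n s
  obtain b where "\<forall>u x. u \<in> borel_measurable M \<longrightarrow>
      (\<integral>\<^sup>+ y. ennreal (\<bar>u y\<bar> powr p) \<partial>M) \<le> ennreal A \<longrightarrow> \<bar>ball_average M x R u\<bar> \<le> b"
    using ball_average_bounded[OF p R(1)] ..
  then have b: "\<bar>a n s\<bar> \<le> b" for n s
    by (simp add: a_def bdd)
  \<comment> \<open>The rounded averages, restricted to \<open>S\<close> so that \<open>q n\<close>
    belongs to a finite extensional function space.\<close>
  define q where "q n = (\<lambda>s\<in>S. \<lfloor>a n s / \<eta>\<rfloor>)" for n
  have "q n \<in> S \<rightarrow>\<^sub>E {\<lfloor>- b / \<eta>\<rfloor>..\<lfloor>b / \<eta>\<rfloor>}" for n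
  proof -
    have "- b / \<eta> \<le> a n s / \<eta>" "a n s / \<eta> \<le> b / \<eta>" for s
      using b[of n s] \<eta>(1) by (intro divide_right_mono; simp add: abs_le_iff)+
    then show ?thesis
      unfolding q_def restrict_PiE_iff by (auto intro!: floor_mono)
  qed
  then have "range q \<subseteq> S \<rightarrow>\<^sub>E {\<lfloor>- b / \<eta>\<rfloor>..\<lfloor>b / \<eta>\<rfloor>}"
    by (rule image_subsetI)
  then have "finite (range q)"
    by (rule finite_subset) (rule finite_PiE[OF S(1) finite_atLeastAtMost_int])
  then obtain n0 where inf: "infinite {n. q n = q n0}"
    using pigeonhole_infinite[of "UNIV :: nat set" q] by auto
  define r where "r = enumerate {n. q n = q n0}"
  have r: "strict_mono r"
    unfolding r_def using strict_mono_enumerate[OF inf] .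
  have qr: "q (r i) = q n0" for i
    using enumerate_in_set[OF inf, of i] by (simp add: r_def)
  have close: "\<bar>a (r i) s - a (r j) s\<bar> powr p \<le> \<eta> powr p" if "s \<in> S" for i j s
  proof -
    have "q (r i) s = q (r j) s" by (simp add: qr)
    then have "\<lfloor>a (r i) s / \<eta>\<rfloor> = \<lfloor>a (r j) s / \<eta>\<rfloor>"
      using that by (simp add: q_def)
    then have "\<bar>a (r i) s / \<eta> - a (r j) s / \<eta>\<bar> \<le> 1"
      by linarith
    then have "\<bar>a (r i) s - a (r j) s\<bar> / \<eta> \<le> 1"
      using \<eta>(1) by (simp flip: diff_divide_distrib)
    then show ?thesis
      using \<eta>(1) p by (intro powr_mono2) auto
  qed
  let ?O = "\<lambda>n s. \<integral>\<^sup>+ y\<in>ball s R. ennreal (\<bar>u n y - a n s\<bar> powr p) \<partial>M"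
  have O: "(\<Sum>s\<in>S. ?O n s) \<le> ennreal (N * R powr p * A)" for n
  proof -
    have "(\<Sum>s\<in>S. ?O n s) \<le> ennreal (N * R powr p) * (\<integral>\<^sup>+ y. ennreal_powr (pointwise_Lip (u n) y) p \<partial>M)"
      unfolding a_def by (rule sum_poincare[OF lip R(1) S(1,2)])
    also have "\<dots> \<le> ennreal (N * R powr p) * ennreal A"
      by (intro mult_left_mono Lip) simp
    finally show ?thesis
      using N A by (simp add: ennreal_mult)
  qed
  have "(\<integral>\<^sup>+ y. ennreal (\<bar>u (r i) y - u (r j) y\<bar> powr p) \<partial>M) \<le> ennreal \<delta>" for i j
  proof -
    let ?d = "\<lambda>y. ennreal (\<bar>u (r i) y - u (r j) y\<bar> powr p)"
    \<comment> \<open>The balls about the net cover the space.\<close>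
    have "(\<integral>\<^sup>+ y. ?d y \<partial>M) \<le> (\<integral>\<^sup>+ y. (\<Sum>s\<in>S. ?d y * indicator (ball s R) y) \<partial>M)"
    proof (intro nn_integral_mono)
      fix y
      obtain s where s: "s \<in> S" "dist s y < R" using S(3) by blast
      then have "?d y \<le> ?d y * indicator (ball s R) y" by simp
      also have "\<dots> \<le> (\<Sum>s\<in>S. ?d y * indicator (ball s R) y)"
        using s(1) S(1) by (intro member_le_sum) auto
      finally show "?d y \<le> (\<Sum>s\<in>S. ?d y * indicator (ball s R) y)" .
    qed
    also have "\<dots> = (\<Sum>s\<in>S. \<integral>\<^sup>+ y\<in>ball s R. ?d y \<partial>M)"
      by (intro nn_integral_sum) measurable
    also have "\<dots> \<le> (\<Sum>s\<in>S. ennreal (4 powr p) * (?O (r i) s + ?O (r j) s + ennreal (\<eta> powr p * measure M UNIV)))"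
    proof (intro sum_mono)
      fix s assume s: "s \<in> S"
      \<comment> \<open>The term \<open>\<eta> powr p\<close> is integrated over the whole space
        instead of the ball; summation over \<open>S\<close> then gives the factor
        \<open>m\<close>.\<close>
      have "(\<integral>\<^sup>+ y\<in>ball s R. ?d y \<partial>M) \<le> (\<integral>\<^sup>+ y. ennreal (4 powr p) *
          (ennreal (\<bar>u (r i) y - a (r i) s\<bar> powr p) * indicator (ball s R) y
            + ennreal (\<bar>u (r j) y - a (r j) s\<bar> powr p) * indicator (ball s R) y + ennreal (\<eta> powr p)) \<partial>M)"
      proof (intro nn_integral_mono)
        fix y
        have "\<bar>u (r i) y - u (r j) y\<bar> powr p \<le> 4 powr p *
            (\<bar>u (r i) y - a (r i) s\<bar> powr p + \<bar>u (r j) y - a (r j) s\<bar> powr p + \<bar>a (r i) s - a (r j) s\<bar> powr p)"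
          using p by (intro powr_diff_quadrangle) simp
        also have "\<dots> \<le> 4 powr p *
            (\<bar>u (r i) y - a (r i) s\<bar> powr p + \<bar>u (r j) y - a (r j) s\<bar> powr p + \<eta> powr p)"
          by (intro mult_left_mono add_left_mono close s) simp
        finally show "?d y * indicator (ball s R) y \<le> ennreal (4 powr p) *
          (ennreal (\<bar>u (r i) y - a (r i) s\<bar> powr p) * indicator (ball s R) y
            + ennreal (\<bar>u (r j) y - a (r j) s\<bar> powr p) * indicator (ball s R) y + ennreal (\<eta> powr p))"
          by (cases "y \<in> ball s R") (simp_all flip: ennreal_mult ennreal_plus)
      qed
      also have "\<dots> = ennreal (4 powr p) * (?O (r i) s + ?O (r j) s + ennreal (\<eta> powr p * measure M UNIV))"
        by (simp add: nn_integral_cmult nn_integral_add space_M emeasure_eq_measure ennreal_mult)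
      finally show "(\<integral>\<^sup>+ y\<in>ball s R. ?d y \<partial>M)
          \<le> ennreal (4 powr p) * (?O (r i) s + ?O (r j) s + ennreal (\<eta> powr p * measure M UNIV))" .
    qed
    also have "\<dots> = ennreal (4 powr p) * ((\<Sum>s\<in>S. ?O (r i) s) + (\<Sum>s\<in>S. ?O (r j) s) + ennreal (\<eta> powr p * m))"
      by (simp add: sum.distrib m_def mult_ac ennreal_mult ennreal_of_nat_eq_real_of_nat flip: sum_distrib_left)
    also have "\<dots> \<le> ennreal (4 powr p) * (ennreal (N * R powr p * A) + ennreal (N * R powr p * A) + ennreal (\<eta> powr p * m))"
      by (intro mult_left_mono add_mono O) auto
    also have "\<dots> = ennreal (4 powr p * (N * R powr p * A + N * R powr p * A + \<eta> powr p * m))"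
      using N A m by (simp flip: ennreal_mult ennreal_plus)
    also have "\<dots> \<le> ennreal \<delta>"
    proof (rule ennreal_leI)
      have "4 powr p * (N * R powr p * A) = \<delta> / 4"
        using N A by (simp add: R(2))
      moreover have "4 powr p * (\<eta> powr p * m) = \<delta> / 2 * (m / (m + 1))"
        using m by (simp add: \<eta>(2))
      moreover have "\<delta> / 2 * (m / (m + 1)) \<le> \<delta> / 2 * 1"
        using m \<delta> by (intro mult_left_mono) auto
      ultimately show "4 powr p * (N * R powr p * A + N * R powr p * A + \<eta> powr p * m) \<le> \<delta>"
        unfolding distrib_left by linarith
    qed
    finally show ?thesis .
  qed
  with r show ?thesis by blast
qed

end

theorem theorem5p3:
  fixes p :: real and M :: "'a::metric_space measure"
    and \<epsilon> :: "nat \<Rightarrow> real" and f :: "nat \<Rightarrow> 'a \<Rightarrow> real"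
  assumes "1 \<le> p"
    and "cheeger_space p M"
    and "compact (UNIV :: 'a set)"
    and "\<And>n. 0 < \<epsilon> n"
    and "\<epsilon> \<longlonglongrightarrow> 0"
    and "\<And>n. 1 \<le> n \<Longrightarrow> f n \<in> KS_space p M"
    and "liminf (\<lambda>n. KS_energy p M (\<epsilon> n) (f n) + ennreal (Lp_norm p M (f n) powr p)) < \<infinity>"
  shows "\<exists>\<phi> :: nat \<Rightarrow> nat. strict_mono \<phi> \<and> (\<forall>k. 1 \<le> \<phi> k) \<and>
           (\<exists>g \<in> Lp_funs p M. (\<lambda>k. Lp_norm p M (\<lambda>x. f (\<phi> k) x - g x)) \<longlonglongrightarrow> 0)"
proof -
  note p = assms(1) and \<epsilon>_pos = assms(4)
  interpret cheeger_space p M by (rule assms(2))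
  have sets_M: "sets M = sets borel" and finite_M: "emeasure M UNIV < \<infinity>"
    using radon assms(3) unfolding radon_measure_def by blast+
  interpret finite_measure M
    using finite_M sets_eq_imp_space_eq[OF sets_M] by (intro finite_measureI) simp
  obtain C :: real where C: "0 < C" "\<And>x r. 0 < r \<Longrightarrow> 0 < emeasure M (ball x (2 * r)) \<and>
      emeasure M (ball x (2 * r)) \<le> ennreal C * emeasure M (ball x r)"
    using doubling by blast
  interpret doubling_bounded M C
  proof
    \<comment> \<open>Positivity is available for balls of radius \<open>2 * r\<close>, hence the
      radius \<open>r / 2\<close>.\<close>
    show "0 < measure M (ball x r)" if "0 < r" for x r
      using C(2)[of "r / 2" x] that by (simp add: emeasure_eq_measure)
    show "measure M (ball x (2 * r)) \<le> C * measure M (ball x r)" if "0 < r" for x r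
      using C(2)[OF that, of x] C(1) by (simp add: emeasure_eq_measure flip: ennreal_mult)
    show "bounded (UNIV :: 'a set)"
      using assms(3) by (rule compact_imp_bounded)
  qed (use sets_M finite_M in auto)
  obtain c \<Lambda> :: real where PI: "0 < c" "1 \<le> \<Lambda>"
    "\<And>f x R. \<exists>L. L-lipschitz_on UNIV f \<Longrightarrow> 0 < R \<Longrightarrow>
      (\<integral>\<^sup>+ y\<in>ball x R. ennreal (\<bar>f y - ball_average M x R f\<bar> powr p) \<partial>M)
        \<le> ennreal (c * R powr p) * (\<integral>\<^sup>+ y\<in>ball x (\<Lambda> * R). ennreal_powr (pointwise_Lip f y) p \<partial>M)"
    using poincare by blast
  obtain N where N: "0 < N"
    "\<And>f R S. \<exists>L. L-lipschitz_on UNIV f \<Longrightarrow> 0 < R \<Longrightarrow> finite S \<Longrightarrow> pairwise (\<lambda>s t. R \<le> dist s t) S \<Longrightarrow>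
      (\<Sum>s\<in>S. \<integral>\<^sup>+ y\<in>ball s R. ennreal (\<bar>f y - ball_average M s R f\<bar> powr p) \<partial>M)
        \<le> ennreal (N * R powr p) * (\<integral>\<^sup>+ y. ennreal_powr (pointwise_Lip f y) p \<partial>M)"
    using sum_poincare[OF PI] by blast
  obtain B where B: "0 < B"
    "\<And>e f. 0 < e \<Longrightarrow> f \<in> Lp_funs p M \<Longrightarrow>
      (\<integral>\<^sup>+ x. ennreal (\<bar>f x - mollify M e f x\<bar> powr p) \<partial>M) \<le> ennreal (B * e powr p) * KS_energy p M e f"
    "\<And>e f. 0 < e \<Longrightarrow> f \<in> Lp_funs p M \<Longrightarrow>
      (\<integral>\<^sup>+ x. ennreal_powr (pointwise_Lip (mollify M e f) x) p \<partial>M) \<le> ennreal B * KS_energy p M e f"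
    using mollify_bounds[OF p] by blast

  \<comment> \<open>Infinitely many indices with bounded energy and norm\<close>
  let ?E = "\<lambda>n. KS_energy p M (\<epsilon> n) (f n) + ennreal (Lp_norm p M (f n) powr p)"
  obtain K0 :: nat where K0: "liminf ?E < of_nat K0"
    using ennreal_Ex_less_of_nat assms(7) by (auto simp: infinity_ennreal_def)
  define K where "K = real K0 + 1"
  have K: "0 < K" "liminf ?E < ennreal K"
    using less_le_trans[OF K0, of "ennreal K"] by (auto simp: K_def ennreal_of_nat_eq_real_of_nat intro!: ennreal_leI)
  \<comment> \<open>The condition \<open>1 \<le> n\<close> is kept because \<open>f 0\<close> is
    arbitrary. If \<open>I\<close> were finite, \<open>?E\<close> would eventually be at least
    \<open>K\<close>, contrary to the bound on its liminf.\<close>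
  define I where "I = {n. 1 \<le> n \<and> ?E n < ennreal K}"
  have inf: "infinite I"
  proof
    assume "finite I"
    then obtain b where b: "\<And>n. n \<in> I \<Longrightarrow> n < b"
      by (meson bounded_nat_set_is_finite finite_nat_set_iff_bounded)
    have "\<forall>\<^sub>F n in sequentially. ennreal K \<le> ?E n"
      using eventually_ge_at_top[of "max 1 b"]
    proof eventually_elim
      case (elim n)
      then have "n \<notin> I" using b[of n] by auto
      then show ?case using elim by (auto simp: I_def)
    qed
    then have "ennreal K \<le> liminf ?E"
      by (rule Liminf_bounded)
    then show False using K(2) by simp
  qed

  \<comment> \<open>Uniform bounds for the mollified functions\<close>
  define \<psi> where "\<psi> = enumerate I"
  define F where "F k = f (\<psi> k)" for k
  define e where "e k = \<epsilon> (\<psi> k)" for k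
  define G where "G k = mollify M (e k) (F k)" for k
  have \<psi>: "strict_mono \<psi>"
    unfolding \<psi>_def by (rule strict_mono_enumerate[OF inf])
  have \<psi>I: "\<psi> k \<in> I" for k
    unfolding \<psi>_def by (rule enumerate_in_set[OF inf])
  have e: "0 < e k" for k
    by (simp add: e_def \<epsilon>_pos)
  have e0: "e \<longlonglongrightarrow> 0"
    using LIMSEQ_subseq_LIMSEQ[OF assms(5) \<psi>] by (simp add: e_def[abs_def] o_def)
  have F: "F k \<in> Lp_funs p M" for k
    using assms(6)[of "\<psi> k"] \<psi>I[of k] by (simp add: F_def KS_space_def I_def)
  have Fm[measurable]: "F k \<in> borel_measurable M" and Fp: "integrable M (\<lambda>x. \<bar>F k x\<bar> powr p)" for k
    using F[of k] by (auto simp: Lp_funs_def)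
  have EK: "KS_energy p M (e k) (F k) \<le> ennreal K" for k
  proof -
    have "KS_energy p M (e k) (F k) \<le> ?E (\<psi> k)"
      by (simp add: e_def F_def)
    also have "\<dots> \<le> ennreal K"
      using \<psi>I[of k] by (simp add: I_def less_imp_le)
    finally show ?thesis .
  qed
  have FK: "(\<integral>\<^sup>+ x. ennreal (\<bar>F k x\<bar> powr p) \<partial>M) \<le> ennreal K" for k
  proof -
    have "(\<integral>\<^sup>+ x. ennreal (\<bar>F k x\<bar> powr p) \<partial>M) = ennreal (Lp_norm p M (F k) powr p)"
      using Fp p by (simp add: nn_integral_eq_integral Lp_norm_def powr_powr)
    also have "\<dots> \<le> ?E (\<psi> k)"
      by (simp add: F_def)
    also have "\<dots> \<le> ennreal K"
      using \<psi>I[of k] by (simp add: I_def less_imp_le)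
    finally show ?thesis .
  qed
  have FG: "(\<integral>\<^sup>+ x. ennreal (\<bar>F k x - G k x\<bar> powr p) \<partial>M) \<le> ennreal (B * K * e k powr p)" for k
  proof -
    have "(\<integral>\<^sup>+ x. ennreal (\<bar>F k x - G k x\<bar> powr p) \<partial>M) \<le> ennreal (B * e k powr p) * KS_energy p M (e k) (F k)"
      unfolding G_def by (rule B(2)[OF e F])
    also have "\<dots> \<le> ennreal (B * e k powr p) * ennreal K"
      by (intro mult_left_mono EK) simp
    finally show ?thesis
      using B(1) K(1) by (simp add: mult_ac flip: ennreal_mult)
  qed
  have Glip: "\<exists>L. L-lipschitz_on UNIV (G k)" for k
    unfolding G_def using mollify_lipschitz[OF e] integrable_of_integrable_powr[OF p Fm Fp] .
  then have Gm[measurable]: "G k \<in> borel_measurable M" for k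
    using lipschitz_on_continuous_on by (intro measurable_continuous) blast
  have GLip: "(\<integral>\<^sup>+ x. ennreal_powr (pointwise_Lip (G k) x) p \<partial>M) \<le> ennreal (B * K)" for k
  proof -
    have "(\<integral>\<^sup>+ x. ennreal_powr (pointwise_Lip (G k) x) p \<partial>M) \<le> ennreal B * KS_energy p M (e k) (F k)"
      unfolding G_def by (rule B(3)[OF e F])
    also have "\<dots> \<le> ennreal B * ennreal K"
      by (intro mult_left_mono EK) simp
    finally show ?thesis
      using B(1) K(1) by (simp flip: ennreal_mult)
  qed
  \<comment> \<open>The limit is 0, as \<open>0 powr p = 0\<close>. It is used twice: for the bound
    \<open>a\<close> on all terms, and at the end to make \<open>F k - G k\<close> small.\<close>
  have ep0: "(\<lambda>k. B * K * e k powr p) \<longlonglongrightarrow> B * K * (0 powr p)"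
    using p less_imp_le[OF e]
    by (intro tendsto_mult tendsto_powr2 e0 tendsto_const always_eventually) auto
  obtain a where "\<forall>x\<in>range (\<lambda>k. B * K * e k powr p). norm x \<le> a"
    using convergent_imp_bounded[OF ep0] unfolding bounded_iff ..
  then have a: "B * K * e k powr p \<le> a" for k
    unfolding ball_simps real_norm_def abs_le_iff by blast
  have G: "(\<integral>\<^sup>+ x. ennreal (\<bar>G k x\<bar> powr p) \<partial>M) \<le> ennreal (2 powr p * (a + K))" for k
  proof -
    have a0: "0 \<le> a"
      using order_trans[OF _ a[of k]] B(1) K(1) by simp
    have "(\<integral>\<^sup>+ x. ennreal (\<bar>G k x - 0\<bar> powr p) \<partial>M)
        \<le> ennreal (2 powr p) * ((\<integral>\<^sup>+ x. ennreal (\<bar>G k x - F k x\<bar> powr p) \<partial>M)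
          + (\<integral>\<^sup>+ x. ennreal (\<bar>F k x - 0\<bar> powr p) \<partial>M))"
      using p by (intro nn_integral_powr_diff_triangle) auto
    also have "\<dots> \<le> ennreal (2 powr p) * (ennreal a + ennreal K)"
      using order_trans[OF FG[of k] ennreal_leI[OF a[of k]]] FK[of k]
      by (intro mult_left_mono add_mono) (auto simp: abs_minus_commute)
    finally show ?thesis
      using a0 K(1) by (simp flip: ennreal_plus ennreal_mult)
  qed
  \<comment> \<open>\<open>small_oscillation_subseq\<close> takes a single constant for the norm and
    the Lipschitz integral.\<close>
  define A where "A = max (B * K) (2 powr p * (a + K))"
  have A: "0 < A"
    using B(1) K(1) by (simp add: A_def less_max_iff_disj)

  \<comment> \<open>Extraction of a Cauchy subsequence and its limit\<close>
  have "\<exists>r. strict_mono (r::nat \<Rightarrow> nat) \<and> (\<forall>i j.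
      (\<integral>\<^sup>+ x. ennreal (\<bar>G (s (r i)) x - G (s (r j)) x\<bar> powr p) \<partial>M) \<le> ennreal (1 / Suc n))"
    for n and s :: "nat \<Rightarrow> nat"
    using order_trans[OF G ennreal_leI[of _ A]] order_trans[OF GLip ennreal_leI[of _ A]]
    by (intro small_oscillation_subseq[OF p _ N(1) A N(2) Glip]) (auto simp: A_def)
  \<comment> \<open>The preceding fact holds along every \<open>s\<close>, so each stage of the
    diagonal construction can refine the previous one.\<close>
  then have "\<exists>r. strict_mono (r::nat \<Rightarrow> nat) \<and> (\<forall>n. \<exists>m. \<forall>i\<ge>m. \<forall>j\<ge>m.
      (\<integral>\<^sup>+ x. ennreal (\<bar>G (r i) x - G (r j) x\<bar> powr p) \<partial>M) \<le> ennreal (1 / Suc n))"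
    by (rule Cauchy_subseq_of_small_subseqs)
  then obtain r where r_cau: "strict_mono (r::nat \<Rightarrow> nat) \<and> (\<forall>n. \<exists>m. \<forall>i\<ge>m. \<forall>j\<ge>m.
      (\<integral>\<^sup>+ x. ennreal (\<bar>G (r i) x - G (r j) x\<bar> powr p) \<partial>M) \<le> ennreal (1 / Suc n))" ..
  note r = r_cau[THEN conjunct1] and cau = r_cau[THEN conjunct2, rule_format]
  have "\<exists>m. \<forall>i\<ge>m. \<forall>j\<ge>m. (\<integral>\<^sup>+ x. ennreal (\<bar>F (r i) x - F (r j) x\<bar> powr p) \<partial>M) \<le> ennreal \<delta>"
    if \<delta>: "0 < \<delta>" for \<delta>
  proof -
    \<comment> \<open>Three errors, two from mollification and one between the mollified functions,
      enter with the factor \<open>4 powr p\<close>.\<close>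
    define d where "d = \<delta> / (3 * 4 powr p)"
    have d: "0 < d" using \<delta> by (simp add: d_def)
    obtain n where n: "1 / Suc n < d"
      using reals_Archimedean[OF d] by (auto simp: inverse_eq_divide)
    obtain m where m: "\<forall>i\<ge>m. \<forall>j\<ge>m.
        (\<integral>\<^sup>+ x. ennreal (\<bar>G (r i) x - G (r j) x\<bar> powr p) \<partial>M) \<le> ennreal (1 / Suc n)"
      using cau ..
    obtain m' where m': "\<And>k. k \<ge> m' \<Longrightarrow> B * K * e k powr p < d"
      using order_tendstoD(2)[OF ep0, of d] d p by (auto simp: eventually_sequentially)
    have "(\<integral>\<^sup>+ x. ennreal (\<bar>F (r i) x - F (r j) x\<bar> powr p) \<partial>M) \<le> ennreal \<delta>"
      if i: "i \<ge> max m m'" and j: "j \<ge> max m m'" for i j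
    proof -
      have FGd: "(\<integral>\<^sup>+ x. ennreal (\<bar>F (r l) x - G (r l) x\<bar> powr p) \<partial>M) \<le> ennreal d" if "l \<ge> max m m'" for l
      proof -
        \<comment> \<open>The smallness of the mollification error is known for large
          \<open>k\<close>, and \<open>r l \<ge> l\<close> carries it to the subsequence.\<close>
        have "m' \<le> r l"
          using that seq_suble[OF r, of l] by simp
        then show ?thesis
          using order_trans[OF FG ennreal_leI] m' less_imp_le by blast
      qed
      have "(\<integral>\<^sup>+ x. ennreal (\<bar>F (r i) x - F (r j) x\<bar> powr p) \<partial>M)
          \<le> (\<integral>\<^sup>+ x. ennreal (4 powr p) * (ennreal (\<bar>F (r i) x - G (r i) x\<bar> powr p)
            + ennreal (\<bar>F (r j) x - G (r j) x\<bar> powr p) + ennreal (\<bar>G (r i) x - G (r j) x\<bar> powr p)) \<partial>M)"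
        using p powr_diff_quadrangle
        by (intro nn_integral_mono) (simp flip: ennreal_plus ennreal_mult)
      also have "\<dots> = ennreal (4 powr p) * ((\<integral>\<^sup>+ x. ennreal (\<bar>F (r i) x - G (r i) x\<bar> powr p) \<partial>M)
            + (\<integral>\<^sup>+ x. ennreal (\<bar>F (r j) x - G (r j) x\<bar> powr p) \<partial>M)
            + (\<integral>\<^sup>+ x. ennreal (\<bar>G (r i) x - G (r j) x\<bar> powr p) \<partial>M))"
        by (simp add: nn_integral_cmult nn_integral_add)
      also have "\<dots> \<le> ennreal (4 powr p) * (ennreal d + ennreal d + ennreal d)"
        using i j order_trans[OF m[rule_format] ennreal_leI] n
        by (intro mult_left_mono add_mono FGd) auto
      also have "\<dots> = ennreal \<delta>"
        using d by (simp add: d_def flip: ennreal_plus ennreal_mult)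
      finally show ?thesis .
    qed
    then show ?thesis by blast
  qed
  then obtain g where "g \<in> Lp_funs p M" "(\<lambda>k. Lp_norm p M (\<lambda>x. F (r k) x - g x)) \<longlonglongrightarrow> 0"
    using Lp_complete[OF p, of "\<lambda>k. F (r k)"] F by blast
  moreover have "strict_mono (\<psi> \<circ> r)"
    using \<psi> r by (rule strict_mono_o)
  moreover have "1 \<le> \<psi> k" for k
    using \<psi>I[of k] by (simp add: I_def)
  ultimately show ?thesis
    by (intro exI[of _ "\<psi> \<circ> r"]) (auto simp: F_def)
qed

end
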